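(* Let $\boldsymbol E\in\mathbb R^d$, let $\boldsymbol N=(N_1,\dots,N_d)$ with all $N_\alpha$ odd positive integers, and let $\boldsymbol A\in C^0_\#(\mathcal Y;\mathbb R^{d\times d})$ be such that there are constants $0<c_A\le C_A<+\infty$ for which, for a.e. $\boldsymbol x\in\mathcal Y$, $\boldsymbol A(\boldsymbol x)$ is symmetric and $c_A\|\boldsymbol v\|_{\mathbb R^d}^2\le(\boldsymbol A(\boldsymbol x)\boldsymbol v,\boldsymbol v)_{\mathbb R^d}\le C_A\|\boldsymbol v\|_{\mathbb R^d}^2$ for all $\boldsymbol v\in\mathbb R^d$. Then the (in general non-symmetric) linear system $$\mathsf G_{\boldsymbol N}\mathsf A_{\boldsymbol N}\tilde{\mathsf e}_{\boldsymbol N}=-\mathsf G_{\boldsymbol N}\mathsf A_{\boldsymbol N}\mathsf E_{\boldsymbol N},\qquad\tilde{\mathsf e}_{\boldsymbol N}\in\mathbb E_{\boldsymbol N},$$ can be solved by the conjugate gradient algorithm for an arbitrary initial guess $\tilde{\mathsf e}_{\boldsymbol N,(0)}\in\mathbb E_{\boldsymbol N}$; that is, the conjugate gradient algorithm applied to the matrix $\mathsf G_{\boldsymbol N}\mathsf A_{\boldsymbol N}$ and right-hand side $-\mathsf G_{\boldsymbol N}\mathsf A_{\boldsymbol N}\mathsf E_{\boldsymbol N}$ is (in exact arithmetic) well defined as long as the residual is nonzero, and after finitely many steps it reaches the solution $\tilde{\mathsf e}_{\boldsymbol N}\in\mathbb E_{\boldsymbol N}$ of the system.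
   Context: Let $\mathcal Y=\prod_{\alpha=1}^d[-Y_\alpha,Y_\alpha]\subset\mathbb R^d$ with $Y_\alpha>0$. $L^2_\#(\mathcal Y;\mathbb X)$ and $C^0_\#(\mathcal Y;\mathbb X)$ are the spaces of $\mathcal Y$-periodic (period $2Y_\alpha$ in direction $\alpha$) functions $\mathbb R^d\to\mathbb X$ that are locally square-integrable, resp. continuous. For $\boldsymbol k\in\mathbb Z^d$ put $\boldsymbol\xi(\boldsymbol k)=(k_\alpha/Y_\alpha)_\alpha$, $\varphi_{\boldsymbol k}(\boldsymbol x)=\exp(\mathrm i\pi\,\boldsymbol\xi(\boldsymbol k)\cdot\boldsymbol x)$. $\mathscr E=\{\boldsymbol u\in L^2_\#(\mathcal Y;\mathbb R^d):\nabla\times\boldsymbol u=\boldsymbol 0,\ \int_{\mathcal Y}\boldsymbol u\,d\boldsymbol x=\boldsymbol 0\}$, where $\nabla\times\boldsymbol u=\boldsymbol 0$ means $\int_{\mathcal Y}(u_\alpha\partial_\beta v-u_\beta\partial_\alpha v)\,d\boldsymbol x=0$ for all $\alpha,\beta$ and all $v$ in the real periodic Sobolev space $H^1_\#(\mathcal Y)$. For $\boldsymbol N$ with odd entries: $\mathbb Z^d_{\boldsymbol N}=\{\boldsymbol m\in\mathbb Z^d:-N_\alpha/2\le m_\alpha<N_\alpha/2\}$, $h_\alpha=2Y_\alpha/N_\alpha$, $|\boldsymbol N|=\prod_\alpha N_\alpha$, grid points $\boldsymbol x^{\boldsymbol k}_{\boldsymbol N}=(k_\alpha h_\alpha)_\alpha$.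 $\mathscr T^d_{\boldsymbol N}=\{\sum_{\boldsymbol k\in\mathbb Z^d_{\boldsymbol N}}\widehat{\boldsymbol v}^{\boldsymbol k}\varphi_{\boldsymbol k}:\widehat{\boldsymbol v}^{\boldsymbol k}\in\mathbb C^d,\ \widehat{\boldsymbol v}^{\boldsymbol k}=\overline{\widehat{\boldsymbol v}^{-\boldsymbol k}}\}$, $\mathscr E_{\boldsymbol N}=\mathscr E\cap\mathscr T^d_{\boldsymbol N}$. $\mathbb R^{d\times\boldsymbol N}$ is the space of structured vectors $\mathsf v=(\mathsf v^{\boldsymbol k})_{\boldsymbol k\in\mathbb Z^d_{\boldsymbol N}}$, $\mathsf v^{\boldsymbol k}\in\mathbb R^d$, with scalar product $(\mathsf u,\mathsf v)_{\mathbb R^{d\times\boldsymbol N}}=\frac1{|\boldsymbol N|}\sum_{\boldsymbol k}(\mathsf u^{\boldsymbol k},\mathsf v^{\boldsymbol k})_{\mathbb R^d}$. Structured matrices with $d\times d$ blocks $\mathsf M^{\boldsymbol k\boldsymbol m}$ act by $(\mathsf M\mathsf v)^{\boldsymbol k}=\sum_{\boldsymbol m}\mathsf M^{\boldsymbol k\boldsymbol m}\mathsf v^{\boldsymbol m}$ and multiply blockwise. $\mathbb E_{\boldsymbol N}=\{(\boldsymbol u(\boldsymbol x^{\boldsymbol k}_{\boldsymbol N}))_{\boldsymbol k}:\boldsymbol u\in\mathscr E_{\boldsymbol N}\}$, $\mathsf A_{\boldsymbol N}^{\boldsymbol k\boldsymbol m}=\delta_{\boldsymbol k\boldsymbol m}\boldsymbol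 A(\boldsymbol x^{\boldsymbol k}_{\boldsymbol N})$, $\mathsf E_{\boldsymbol N}^{\boldsymbol k}=\boldsymbol E$. With $\omega^{\boldsymbol k\boldsymbol m}_{\boldsymbol N}=\exp(2\pi\mathrm i\sum_\alpha k_\alpha m_\alpha/N_\alpha)$, $\mathsf F_{\boldsymbol N}^{\boldsymbol k\boldsymbol m}=\frac1{|\boldsymbol N|}\omega_{\boldsymbol N}^{-\boldsymbol k\boldsymbol m}\boldsymbol I$, $(\mathsf F_{\boldsymbol N}^{-1})^{\boldsymbol k\boldsymbol m}=\omega_{\boldsymbol N}^{\boldsymbol k\boldsymbol m}\boldsymbol I$, set $\mathsf G_{\boldsymbol N}=\mathsf F_{\boldsymbol N}^{-1}\widehat{\mathsf G}_{\boldsymbol N}\mathsf F_{\boldsymbol N}$, where $\widehat{\mathsf G}_{\boldsymbol N}^{\boldsymbol k\boldsymbol m}=\delta_{\boldsymbol k\boldsymbol m}\dfrac{\boldsymbol\xi(\boldsymbol k)\otimes\boldsymbol\xi(\boldsymbol k)}{\|\boldsymbol\xi(\boldsymbol k)\|_{\mathbb R^d}^2}$ for $\boldsymbol k\ne\boldsymbol 0$ and $\widehat{\mathsf G}_{\boldsymbol N}^{\boldsymbol 0\boldsymbol m}=\boldsymbol 0$. The conjugate gradient algorithm for a system $\mathsf B\mathsf x=\mathsf b$ on $\mathbb R^{d\times\boldsymbol N}$ with initial guess $\mathsf x_{(0)}$ is the standard (Hestenes–Stiefel) iteration: $\mathsf r_{(0)}=\mathsf b-\mathsf B\mathsf x_{(0)}$,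 $\mathsf p_{(0)}=\mathsf r_{(0)}$, and while $\mathsf r_{(i)}\neq 0$: $a_i=(\mathsf r_{(i)},\mathsf r_{(i)})/(\mathsf B\mathsf p_{(i)},\mathsf p_{(i)})$, $\mathsf x_{(i+1)}=\mathsf x_{(i)}+a_i\mathsf p_{(i)}$, $\mathsf r_{(i+1)}=\mathsf r_{(i)}-a_i\mathsf B\mathsf p_{(i)}$, $b_i=(\mathsf r_{(i+1)},\mathsf r_{(i+1)})/(\mathsf r_{(i)},\mathsf r_{(i)})$, $\mathsf p_{(i+1)}=\mathsf r_{(i+1)}+b_i\mathsf p_{(i)}$, with the scalar product of $\mathbb R^{d\times\boldsymbol N}$. *)

theory Defs
  imports "HOL-Analysis.Analysis"
begin

section \<open>Periodic function spaces\<close>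

definition cell :: "real^'n \<Rightarrow> (real^'n) set" where
  "cell Y = cbox (- Y) Y"

definition periodic :: "real^'n \<Rightarrow> (real^'n \<Rightarrow> 'a) \<Rightarrow> bool" where
  "periodic Y f \<longleftrightarrow> (\<forall>x \<alpha>. f (x + axis \<alpha> (2 * Y $ \<alpha>)) = f x)"

definition C0_per :: "real^'n \<Rightarrow> (real^'n \<Rightarrow> 'a::topological_space) set" where
  "C0_per Y = {f. periodic Y f \<and> continuous_on UNIV f}"

text \<open>The elements of \<open>L2_per\<close>, and of the spaces built from it, are functions rather than classes of
  functions modulo null sets; every condition below that is stated through integrals is invariant
  under modification on null sets.\<close>

definition L2_per :: "real^'n \<Rightarrow> (real^'n \<Rightarrow> 'a::euclidean_space) set" where
  "L2_per Y = {f. periodic Y f \<and> f \<in> borel_measurable lebesgue \<and>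
     (\<forall>K. compact K \<longrightarrow> set_integrable lebesgue K (\<lambda>x. (norm (f x))\<^sup>2))}"

definition pderiv_at :: "'n \<Rightarrow> (real^'n \<Rightarrow> real) \<Rightarrow> real^'n \<Rightarrow> real" where
  "pderiv_at \<alpha> f x = frechet_derivative f (at x) (axis \<alpha> 1)"

primrec Ck :: "nat \<Rightarrow> (real^'n \<Rightarrow> real) \<Rightarrow> bool" where
  "Ck 0 f = continuous_on UNIV f"
| "Ck (Suc j) f = ((\<forall>x. f differentiable (at x)) \<and> (\<forall>\<alpha>. Ck j (pderiv_at \<alpha> f)))"

definition Cinf_per :: "real^'n \<Rightarrow> (real^'n \<Rightarrow> real) set" where
  "Cinf_per Y = {f. periodic Y f \<and> (\<forall>j. Ck j f)}"

text \<open>The weak gradient is taken in the sense of periodic distributions: the test functions are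
  smooth and periodic, so that integration by parts over the cell has no boundary terms.\<close>

definition weak_gradient :: "real^'n \<Rightarrow> (real^'n \<Rightarrow> real) \<Rightarrow> (real^'n \<Rightarrow> real^'n) \<Rightarrow> bool" where
  "weak_gradient Y v g \<longleftrightarrow> g \<in> L2_per Y \<and>
     (\<forall>\<phi>\<in>Cinf_per Y. \<forall>\<alpha>.
        (LINT x:cell Y|lebesgue. v x * pderiv_at \<alpha> \<phi> x) =
        - (LINT x:cell Y|lebesgue. g x $ \<alpha> * \<phi> x))"

definition H1_per :: "real^'n \<Rightarrow> (real^'n \<Rightarrow> real) set" where
  "H1_per Y = {v \<in> L2_per Y. \<exists>g. weak_gradient Y v g}"

text \<open>The weak gradient is determined up to null sets, so quantifying over all \<open>g\<close> is harmless.\<close>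

definition curl_free :: "real^'n \<Rightarrow> (real^'n \<Rightarrow> real^'n) \<Rightarrow> bool" where
  "curl_free Y u \<longleftrightarrow>
     (\<forall>v\<in>H1_per Y. \<forall>g. weak_gradient Y v g \<longrightarrow>
        (\<forall>\<alpha> \<beta>. (LINT x:cell Y|lebesgue. u x $ \<alpha> * g x $ \<beta> - u x $ \<beta> * g x $ \<alpha>) = 0))"

definition Espace :: "real^'n \<Rightarrow> (real^'n \<Rightarrow> real^'n) set" where
  "Espace Y = {u \<in> L2_per Y. curl_free Y u \<and> (LINT x:cell Y|lebesgue. u x) = 0}"

section \<open>Trigonometric polynomials\<close>

definition freq :: "real^'n \<Rightarrow> int^'n \<Rightarrow> real^'n" where
  "freq Y k = (\<chi> \<alpha>. of_int (k $ \<alpha>) / Y $ \<alpha>)"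

definition four :: "real^'n \<Rightarrow> int^'n \<Rightarrow> real^'n \<Rightarrow> complex" where
  "four Y k x = exp (\<i> * of_real (pi * (freq Y k \<bullet> x)))"

definition idx :: "nat^'n \<Rightarrow> (int^'n) set" where
  "idx N = {m. \<forall>\<alpha>. - (real (N $ \<alpha>) / 2) \<le> of_int (m $ \<alpha>) \<and> of_int (m $ \<alpha>) < real (N $ \<alpha>) / 2}"

definition grid :: "real^'n \<Rightarrow> nat^'n \<Rightarrow> int^'n \<Rightarrow> real^'n" where
  "grid Y N k = (\<chi> \<alpha>. of_int (k $ \<alpha>) * (2 * Y $ \<alpha> / real (N $ \<alpha>)))"

definition trig_poly :: "real^'n \<Rightarrow> nat^'n \<Rightarrow> (real^'n \<Rightarrow> complex^'n) set" where
  "trig_poly Y N = {(\<lambda>x. \<Sum>k\<in>idx N. four Y k x *s c k) | c.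
     \<forall>k\<in>idx N. \<forall>\<alpha>. c k $ \<alpha> = cnj (c (- k) $ \<alpha>)}"

text \<open>The intersection of \<open>Espace Y\<close> with \<open>trig_poly Y N\<close>, real vectors being embedded into
  complex ones.\<close>

definition EN_space :: "real^'n \<Rightarrow> nat^'n \<Rightarrow> (real^'n \<Rightarrow> real^'n) set" where
  "EN_space Y N = {u \<in> Espace Y. (\<lambda>x. \<chi> \<alpha>. complex_of_real (u x $ \<alpha>)) \<in> trig_poly Y N}"

section \<open>Structured vectors and matrices\<close>

text \<open>A structured vector is a function on all multi-indices that vanishes outside \<open>idx N\<close>, so that
  equality of structured vectors is equality of functions. Structured matrices are only ever
  evaluated at indices in \<open>idx N\<close>.\<close>

type_synonym 'n svec = "int^'n \<Rightarrow> real^'n"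
type_synonym ('a, 'n) smat = "int^'n \<Rightarrow> int^'n \<Rightarrow> 'a^'n^'n"

definition svec_of :: "nat^'n \<Rightarrow> (int^'n \<Rightarrow> real^'n) \<Rightarrow> 'n svec" where
  "svec_of N f = (\<lambda>k. if k \<in> idx N then f k else 0)"

definition sdot :: "nat^'n \<Rightarrow> 'n svec \<Rightarrow> 'n svec \<Rightarrow> real" where
  "sdot N u v = (\<Sum>k\<in>idx N. u k \<bullet> v k) / real (\<Prod>\<alpha>\<in>UNIV. N $ \<alpha>)"

definition sapply :: "nat^'n \<Rightarrow> (real, 'n) smat \<Rightarrow> 'n svec \<Rightarrow> 'n svec" where
  "sapply N M v = svec_of N (\<lambda>k. \<Sum>m\<in>idx N. M k m *v v m)"

definition smult :: "nat^'n \<Rightarrow> ('a::semiring_1, 'n) smat \<Rightarrow> ('a, 'n) smat \<Rightarrow> ('a, 'n) smat" where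
  "smult N A B = (\<lambda>k m. \<Sum>l\<in>idx N. A k l ** B l m)"

definition Ebb :: "real^'n \<Rightarrow> nat^'n \<Rightarrow> 'n svec set" where
  "Ebb Y N = {svec_of N (\<lambda>k. u (grid Y N k)) | u. u \<in> EN_space Y N}"

definition A_mat :: "real^'n \<Rightarrow> nat^'n \<Rightarrow> (real^'n \<Rightarrow> real^'n^'n) \<Rightarrow> (real, 'n) smat" where
  "A_mat Y N A = (\<lambda>k m. if k = m then A (grid Y N k) else 0)"

definition E_vec :: "nat^'n \<Rightarrow> real^'n \<Rightarrow> 'n svec" where
  "E_vec N E = svec_of N (\<lambda>_. E)"

definition omega :: "nat^'n \<Rightarrow> int^'n \<Rightarrow> int^'n \<Rightarrow> complex" where
  "omega N k m = exp (2 * of_real pi * \<i> *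
     (\<Sum>\<alpha>\<in>UNIV. of_int (k $ \<alpha>) * of_int (m $ \<alpha>) / of_nat (N $ \<alpha>)))"

definition F_mat :: "nat^'n \<Rightarrow> (complex, 'n) smat" where
  "F_mat N = (\<lambda>k m. mat (omega N (- k) m / of_nat (\<Prod>\<alpha>\<in>UNIV. N $ \<alpha>)))"

definition Finv_mat :: "nat^'n \<Rightarrow> (complex, 'n) smat" where
  "Finv_mat N = (\<lambda>k m. mat (omega N k m))"

definition Ghat_mat :: "real^'n \<Rightarrow> (real, 'n) smat" where
  "Ghat_mat Y = (\<lambda>k m. if k = m \<and> k \<noteq> 0
     then (\<chi> \<alpha> \<beta>. freq Y k $ \<alpha> * freq Y k $ \<beta> / (norm (freq Y k))\<^sup>2) else 0)"

definition Gc_mat :: "real^'n \<Rightarrow> nat^'n \<Rightarrow> (complex, 'n) smat" where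
  "Gc_mat Y N = smult N (smult N (Finv_mat N) (\<lambda>k m. map_matrix of_real (Ghat_mat Y k m))) (F_mat N)"

text \<open>For odd \<open>N\<close> the entries of \<open>Gc_mat Y N\<close> are real (lemma \<open>G_mat_real\<close> below); \<open>G_mat Y N\<close> is the
  same matrix, regarded as a matrix with real entries.\<close>

definition G_mat :: "real^'n \<Rightarrow> nat^'n \<Rightarrow> (real, 'n) smat" where
  "G_mat Y N = (\<lambda>k m. map_matrix Re (Gc_mat Y N k m))"

definition GA_mat :: "real^'n \<Rightarrow> nat^'n \<Rightarrow> (real^'n \<Rightarrow> real^'n^'n) \<Rightarrow> (real, 'n) smat" where
  "GA_mat Y N A = smult N (G_mat Y N) (A_mat Y N A)"

definition rhs_vec :: "real^'n \<Rightarrow> nat^'n \<Rightarrow> (real^'n \<Rightarrow> real^'n^'n) \<Rightarrow> real^'n \<Rightarrow> 'n svec" where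
  "rhs_vec Y N A E = (\<lambda>k. - sapply N (GA_mat Y N A) (E_vec N E) k)"

lemma finite_idx: "finite (idx (N :: nat^'n))"
proof -
  have "idx N \<subseteq> vec_lambda ` (PiE UNIV (\<lambda>\<alpha>. {- int (N $ \<alpha>) .. int (N $ \<alpha>)}))"
  proof
    fix m assume m: "m \<in> idx N"
    have "m $ \<alpha> \<in> {- int (N $ \<alpha>) .. int (N $ \<alpha>)}" for \<alpha>
    proof -
      have "- (real (N $ \<alpha>) / 2) \<le> of_int (m $ \<alpha>)" "of_int (m $ \<alpha>) < real (N $ \<alpha>) / 2"
        using m by (auto simp: idx_def)
      then have "real_of_int (- int (N $ \<alpha>)) \<le> of_int (m $ \<alpha>)"
          "real_of_int (m $ \<alpha>) \<le> of_int (int (N $ \<alpha>))" by simp_all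
      then show ?thesis unfolding of_int_le_iff by simp
    qed
    then have "vec_nth m \<in> PiE UNIV (\<lambda>\<alpha>. {- int (N $ \<alpha>) .. int (N $ \<alpha>)})" by auto
    then show "m \<in> vec_lambda ` (PiE UNIV (\<lambda>\<alpha>. {- int (N $ \<alpha>) .. int (N $ \<alpha>)}))"
      by (metis imageI vec_nth_inverse)
  qed
  then show ?thesis by (rule finite_subset) (auto intro!: finite_imageI finite_PiE)
qed

lemma idx_uminus:
  assumes "\<And>\<alpha>. odd (N $ \<alpha>)" "m \<in> idx N"
  shows "- m \<in> idx N"
proof -
  have "- (real (N $ \<alpha>) / 2) \<le> of_int ((- m) $ \<alpha>) \<and> of_int ((- m) $ \<alpha>) < real (N $ \<alpha>) / 2" for \<alpha>
  proof -
    obtain j where j: "N $ \<alpha> = 2 * j + 1" using assms(1) oddE by blast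
    have "- (real (N $ \<alpha>) / 2) \<le> of_int (m $ \<alpha>)" "of_int (m $ \<alpha>) < real (N $ \<alpha>) / 2"
      using assms(2) by (auto simp: idx_def)
    moreover have NR: "real (N $ \<alpha>) = 2 * real j + 1" using j by simp
    ultimately have "- (2 * real j + 1) \<le> 2 * of_int (m $ \<alpha>)" by linarith
    then have "real_of_int (- int (2 * j + 1)) \<le> of_int (2 * m $ \<alpha>)" by simp
    then have "- int (2 * j + 1) \<le> 2 * m $ \<alpha>" unfolding of_int_le_iff by simp
    then have "- int j \<le> m $ \<alpha>" by presburger
    then have "- real j \<le> of_int (m $ \<alpha>)"
      by (metis of_int_le_iff of_int_minus of_int_of_nat_eq)
    show ?thesis using NR \<open>of_int (m $ \<alpha>) < real (N $ \<alpha>) / 2\<close>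
\<open>- real j \<le> of_int (m $ \<alpha>)\<close>
      unfolding vector_uminus_component of_int_minus by linarith
  qed
  then show ?thesis by (simp add: idx_def)
qed

lemma Gc_mat_entry:
  "Gc_mat Y N k m $ \<alpha> $ \<beta> =
     (\<Sum>l\<in>idx N. omega N k l * of_real (Ghat_mat Y l l $ \<alpha> $ \<beta>) *
        (omega N (- l) m / of_nat (\<Prod>\<gamma>\<in>UNIV. N $ \<gamma>)))"
proof -
  let ?H = "\<lambda>k m. map_matrix complex_of_real (Ghat_mat Y k m)"
  have 1: "smult N (Finv_mat N) ?H k l $ \<alpha> $ \<beta> = omega N k l * of_real (Ghat_mat Y l l $ \<alpha> $ \<beta>)"
    if "l \<in> idx N" for l \<alpha> \<beta>
  proof -
    have "smult N (Finv_mat N) ?H k l $ \<alpha> $ \<beta> =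
        (\<Sum>j\<in>idx N. if j = l then omega N k l * of_real (Ghat_mat Y l l $ \<alpha> $ \<beta>) else 0)"
      unfolding smult_def sum_component
    proof (intro sum.cong refl)
      fix j
      have "(Finv_mat N k j ** ?H j l) $ \<alpha> $ \<beta> =
          (\<Sum>\<gamma>\<in>UNIV. (if \<alpha> = \<gamma> then omega N k j else 0) * of_real (Ghat_mat Y j l $ \<gamma> $ \<beta>))"
        by (simp add: Finv_mat_def matrix_matrix_mult_def mat_def)
      also have "\<dots> = omega N k j * of_real (Ghat_mat Y j l $ \<alpha> $ \<beta>)"
        by (simp add: if_distrib[where f="\<lambda>z. z * _"] cong: if_cong)
      finally show "(Finv_mat N k j ** ?H j l) $ \<alpha> $ \<beta> =
          (if j = l then omega N k l * of_real (Ghat_mat Y l l $ \<alpha> $ \<beta>) else 0)"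
        by (auto simp: Ghat_mat_def)
    qed
    then show ?thesis using that by (simp add: finite_idx)
  qed
  have "Gc_mat Y N k m $ \<alpha> $ \<beta> =
      (\<Sum>l\<in>idx N. (smult N (Finv_mat N) ?H k l ** F_mat N l m) $ \<alpha> $ \<beta>)"
    by (simp only: Gc_mat_def smult_def[of N "smult N _ _"] sum_component)
  also have "\<dots> = (\<Sum>l\<in>idx N. omega N k l * of_real (Ghat_mat Y l l $ \<alpha> $ \<beta>) *
        (omega N (- l) m / of_nat (\<Prod>\<gamma>\<in>UNIV. N $ \<gamma>)))"
  proof (intro sum.cong refl)
    fix l assume l: "l \<in> idx N"
    have "(smult N (Finv_mat N) ?H k l ** F_mat N l m) $ \<alpha> $ \<beta> =
       (\<Sum>\<gamma>\<in>UNIV. omega N k l * of_real (Ghat_mat Y l l $ \<alpha> $ \<gamma>) *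
          (if \<gamma> = \<beta> then omega N (- l) m / of_nat (\<Prod>\<gamma>\<in>UNIV. N $ \<gamma>) else 0))"
      unfolding matrix_matrix_mult_def F_mat_def mat_def by (simp add: 1[OF l])
    also have "\<dots> = omega N k l * of_real (Ghat_mat Y l l $ \<alpha> $ \<beta>) *
        (omega N (- l) m / of_nat (\<Prod>\<gamma>\<in>UNIV. N $ \<gamma>))"
      by (simp add: if_distrib[where f="\<lambda>z. _ * z"] cong: if_cong)
    finally show "(smult N (Finv_mat N) ?H k l ** F_mat N l m) $ \<alpha> $ \<beta> =
       omega N k l * of_real (Ghat_mat Y l l $ \<alpha> $ \<beta>) *
        (omega N (- l) m / of_nat (\<Prod>\<gamma>\<in>UNIV. N $ \<gamma>))" .
  qed
  finally show ?thesis .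
qed

lemma G_mat_real:
  assumes N: "\<And>\<alpha>. odd (N $ \<alpha>)"
  shows "map_matrix complex_of_real (G_mat Y N k m) = Gc_mat Y N k m"
proof -
  have cnj_omega: "cnj (omega N k l) = omega N k (- l)" "omega N (- k) (- l) = omega N k l" for k l
    by (simp_all add: omega_def exp_cnj sum_negf)
  have Ghat: "Ghat_mat Y (- l) (- l) = Ghat_mat Y l l" for l
  proof -
    have "freq Y (- l) = - freq Y l" by (simp add: freq_def vec_eq_iff)
    then show ?thesis by (simp add: Ghat_mat_def)
  qed
  have "cnj (Gc_mat Y N k m $ \<alpha> $ \<beta>) = Gc_mat Y N k m $ \<alpha> $ \<beta>" for \<alpha> \<beta>
  proof -
    have "cnj (Gc_mat Y N k m $ \<alpha> $ \<beta>) =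
      (\<Sum>l\<in>idx N. omega N k (- l) * of_real (Ghat_mat Y (- l) (- l) $ \<alpha> $ \<beta>) *
        (omega N (- (- l)) m / of_nat (\<Prod>\<gamma>\<in>UNIV. N $ \<gamma>)))"
      unfolding Gc_mat_entry cnj_sum complex_cnj_mult complex_cnj_divide cnj_omega Ghat minus_minus
      by simp
    also have "\<dots> = Gc_mat Y N k m $ \<alpha> $ \<beta>"
      unfolding Gc_mat_entry
      by (rule sum.reindex_bij_witness[of _ uminus uminus]) (simp_all add: idx_uminus N)
    finally show ?thesis .
  qed
  then have "complex_of_real (Re (Gc_mat Y N k m $ \<alpha> $ \<beta>)) = Gc_mat Y N k m $ \<alpha> $ \<beta>" for \<alpha> \<beta>
    by (simp add: complex_eq_iff)
  then show ?thesis by (simp add: G_mat_def vec_eq_iff)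
qed

section \<open>The conjugate gradient algorithm\<close>

text \<open>The state is the triple of iterate, residual and search direction. Once the residual vanishes
  the algorithm has stopped and the state is kept. Division by zero yields zero in HOL, so the
  well-definedness of a step has to be stated separately; \<open>cg_step_ok\<close> says that both denominators
  occurring in it are nonzero.\<close>

type_synonym 'n cg_state = "'n svec \<times> 'n svec \<times> 'n svec"

definition cg_step :: "nat^'n \<Rightarrow> (real, 'n) smat \<Rightarrow> 'n cg_state \<Rightarrow> 'n cg_state" where
  "cg_step N B = (\<lambda>(x, r, p).
     let a = sdot N r r / sdot N (sapply N B p) p;
         x' = (\<lambda>k. x k + a *\<^sub>R p k);
         r' = (\<lambda>k. r k - a *\<^sub>R sapply N B p k);
         b = sdot N r' r' / sdot N r r;
         p' = (\<lambda>k. r' k + b *\<^sub>R p k)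
     in (x', r', p'))"

definition cg_init :: "nat^'n \<Rightarrow> (real, 'n) smat \<Rightarrow> 'n svec \<Rightarrow> 'n svec \<Rightarrow> 'n cg_state" where
  "cg_init N B b x0 = (let r0 = (\<lambda>k. b k - sapply N B x0 k) in (x0, r0, r0))"

definition cg_iterate :: "'n cg_state \<Rightarrow> 'n svec" where
  "cg_iterate s = fst s"

definition cg_residual :: "'n cg_state \<Rightarrow> 'n svec" where
  "cg_residual s = fst (snd s)"

definition cg_direction :: "'n cg_state \<Rightarrow> 'n svec" where
  "cg_direction s = snd (snd s)"

primrec cg :: "nat^'n \<Rightarrow> (real, 'n) smat \<Rightarrow> 'n svec \<Rightarrow> 'n svec \<Rightarrow> nat \<Rightarrow> 'n cg_state" where
  "cg N B b x0 0 = cg_init N B b x0"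
| "cg N B b x0 (Suc i) =
     (let s = cg N B b x0 i in if cg_residual s = (\<lambda>_. 0) then s else cg_step N B s)"

definition cg_step_ok :: "nat^'n \<Rightarrow> (real, 'n) smat \<Rightarrow> 'n cg_state \<Rightarrow> bool" where
  "cg_step_ok N B s \<longleftrightarrow>
     sdot N (sapply N B (cg_direction s)) (cg_direction s) \<noteq> 0 \<and>
     sdot N (cg_residual s) (cg_residual s) \<noteq> 0"

end

theory Submission
  imports Defs
begin

text \<open>The matrix \<open>G_mat\<close> is the orthogonal projection onto \<open>Ebb\<close>: a trigonometric polynomial
  is curl-free with mean zero iff its Fourier coefficients are fixed by the projections \<open>Ghat_mat\<close>,
  and the discrete Fourier transform recovers these coefficients exactly from the grid values.
  For \<open>u\<close> and \<open>v\<close> in \<open>Ebb\<close> the form \<open>(G A u, v)\<close> therefore equals \<open>(A u, v)\<close>, so that \<open>G A\<close>, although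
  not symmetric on the whole space, restricts to a symmetric positive definite operator on \<open>Ebb\<close>. All
  iterates, residuals and search directions stay in \<open>Ebb\<close>, where the classical theory applies: the
  residuals are mutually orthogonal, hence only finitely many of them are nonzero.\<close>

section \<open>Structured vectors\<close>

text \<open>The problem is posed on the continuous cell, whereas the algorithm sees grid values
  only, and most of the work bridges the two. Curl-freeness is a weak condition; for trigonometric
  polynomials it first has to become a pointwise relation between derivatives and then a relation
  between coefficients. Ellipticity is known almost everywhere only, and the finitely many grid
  points form a null set, so it reaches them through the continuity of \<open>A\<close>. Odd entries
  of \<open>N\<close> make \<open>idx N\<close> closed under negation, which lets Hermitian
  coefficients describe real fields. The right-hand side and every image under \<open>GA_mat\<close>
  lie in the range of \<open>G_mat\<close>, hence so do residuals and directions; the iterates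
  inherit membership in \<open>Ebb\<close> from the initial guess.\<close>

lemma sdot_commute: "sdot N u v = sdot N v u"
  by (simp add: sdot_def inner_commute)

lemma sdot_add_scale_left:
  "sdot N (\<lambda>k. u k + a *\<^sub>R v k) w = sdot N u w + a * sdot N v w"
  by (simp add: sdot_def inner_add_left sum.distrib sum_distrib_left add_divide_distrib)

lemma sdot_diff_scale_left:
  "sdot N (\<lambda>k. u k - a *\<^sub>R v k) w = sdot N u w - a * sdot N v w"
  by (simp add: sdot_def inner_diff_left sum_subtractf sum_distrib_left diff_divide_distrib)

lemma sdot_add_scale_right:
  "sdot N w (\<lambda>k. u k + a *\<^sub>R v k) = sdot N w u + a * sdot N w v"
  by (simp add: sdot_commute[of N w] sdot_add_scale_left)

lemma sdot_diff_scale_right: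
  "sdot N w (\<lambda>k. u k - a *\<^sub>R v k) = sdot N w u - a * sdot N w v"
  by (simp add: sdot_commute[of N w] sdot_diff_scale_left)

text \<open>Only the indices in \<open>idx N\<close> are summed, so definiteness rests on the
  support condition: it places a nonzero block where the sum counts it.\<close>

lemma sdot_pos:
  assumes "\<And>\<alpha>. N $ \<alpha> > 0" "\<And>k. k \<notin> idx N \<Longrightarrow> v k = 0" "v \<noteq> (\<lambda>_. 0)"
  shows "sdot N v v > 0"
proof -
  obtain k where "v k \<noteq> 0" using assms(3) by auto
  moreover from this have "k \<in> idx N" using assms(2) by blast
  ultimately have "(\<Sum>k\<in>idx N. v k \<bullet> v k) > 0"
    by (intro sum_pos2[of _ k]) (auto simp: finite_idx)
  moreover have "real (\<Prod>\<alpha>\<in>UNIV. N $ \<alpha>) > 0"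
    using assms(1) by (simp add: prod_pos)
  ultimately show ?thesis by (simp add: sdot_def)
qed

lemma sapply_add_scale:
  "sapply N M (\<lambda>k. u k + a *\<^sub>R v k) = (\<lambda>k. sapply N M u k + a *\<^sub>R sapply N M v k)"
  by (auto simp: sapply_def svec_of_def matrix_vector_right_distrib matrix_vector_mult_scaleR
      sum.distrib scaleR_sum_right)

lemma sapply_outside: "k \<notin> idx N \<Longrightarrow> sapply N M v k = 0"
  by (simp add: sapply_def svec_of_def)

text \<open>\<open>sapply\<close> cuts its result off outside \<open>idx N\<close>, but the outer
  application reads the inner vector on \<open>idx N\<close> only, so nothing is lost.\<close>

lemma sapply_smult: "sapply N (smult N M M') v = sapply N M (sapply N M' v)"
proof -
  have "(\<Sum>m\<in>idx N. (\<Sum>l\<in>idx N. M k l ** M' l m) *v v m)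
      = (\<Sum>l\<in>idx N. M k l *v (\<Sum>m\<in>idx N. M' l m *v v m))" for k
  proof -
    have 1: "(\<Sum>l\<in>S. X l) *v w = (\<Sum>l\<in>S. X l *v w)" for S and X :: "int^'a \<Rightarrow> real^'a^'a" and w
      by (induction S rule: infinite_finite_induct) (auto simp: matrix_vector_mult_add_rdistrib)
    have 2: "L *v (\<Sum>l\<in>S. X l) = (\<Sum>l\<in>S. L *v X l)" for S and L :: "real^'a^'a" and X :: "int^'a \<Rightarrow> real^'a"
      by (induction S rule: infinite_finite_induct) (auto simp: matrix_vector_right_distrib)
    show ?thesis
      unfolding 1 2 matrix_vector_mul_assoc by (rule sum.swap)
  qed
  then show ?thesis by (auto simp: sapply_def svec_of_def smult_def fun_eq_iff intro!: sum.cong)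
qed

section \<open>Conjugate gradients on an invariant subspace\<close>

text \<open>Sum Bessel's inequality over the coordinate unit vectors: each of the \<open>n\<close> normalised vectors
  contributes 1 in total. The function space is not an instance of \<^class>\<open>real_inner\<close>, so no library
  dimension argument applies.\<close>

lemma orthogonal_family_card:
  fixes r :: "nat \<Rightarrow> 'n::finite svec"
  assumes N: "\<And>\<alpha>. N $ \<alpha> > 0"
    and pos: "\<And>i. i < n \<Longrightarrow> sdot N (r i) (r i) > 0"
    and orth: "\<And>i j. i < n \<Longrightarrow> j < n \<Longrightarrow> i \<noteq> j \<Longrightarrow> sdot N (r i) (r j) = 0"
  shows "n \<le> card (idx N) * CARD('n)"
proof -
  define D where "D = real (\<Prod>\<alpha>\<in>UNIV. N $ \<alpha>)"
  have D: "D > 0" using N by (simp add: D_def prod_pos)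
  define s where "s i = (\<Sum>k\<in>idx N. r i k \<bullet> r i k)" for i
  have s_pos: "s i > 0" if "i < n" for i
    using pos[OF that] D by (simp add: sdot_def s_def zero_less_divide_iff flip: D_def del: of_nat_prod)
  have s_orth: "(\<Sum>k\<in>idx N. r i k \<bullet> r j k) = 0" if "i < n" "j < n" "i \<noteq> j" for i j
    using orth[OF that] D by (simp add: sdot_def flip: D_def del: of_nat_prod)
  have bessel: "(\<Sum>i<n. (r i k $ \<alpha>)\<^sup>2 / s i) \<le> 1" if k: "k \<in> idx N" for k \<alpha>
  proof -
    \<comment> \<open>The \<open>c i\<close> are the Fourier coefficients of the unit vector
      \<open>z\<close> with respect to the orthogonal \<open>r i\<close>, and \<open>w\<close> is
      its projection. The products of \<open>w\<close> with \<open>z\<close> and with itself both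
      equal the Bessel sum, so the squared norm of \<open>z - w\<close> is one minus that
      sum.\<close>
    define c where "c i = r i k $ \<alpha> / s i" for i
    define w where "w m = (\<Sum>i<n. c i *\<^sub>R r i m)" for m
    define z where "z m = (if m = k then axis \<alpha> 1 else (0::real^'n))" for m
    have zw: "(\<Sum>m\<in>idx N. z m \<bullet> w m) = (\<Sum>i<n. (r i k $ \<alpha>)\<^sup>2 / s i)"
    proof -
      have "(\<Sum>m\<in>idx N. z m \<bullet> w m) = (\<Sum>m\<in>idx N. if m = k then w k $ \<alpha> else 0)"
        by (intro sum.cong refl) (simp add: z_def inner_axis')
      also have "\<dots> = w k $ \<alpha>" using k by (simp add: finite_idx)
      also have "\<dots> = (\<Sum>i<n. (r i k $ \<alpha>)\<^sup>2 / s i)"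
        by (simp add: w_def c_def sum_component power2_eq_square)
      finally show ?thesis .
    qed
    have ww: "(\<Sum>m\<in>idx N. w m \<bullet> w m) = (\<Sum>i<n. (r i k $ \<alpha>)\<^sup>2 / s i)"
    proof -
      have "(\<Sum>m\<in>idx N. w m \<bullet> w m)
          = (\<Sum>m\<in>idx N. \<Sum>i<n. \<Sum>j<n. c i * c j * (r i m \<bullet> r j m))"
        unfolding w_def inner_sum_left by (simp add: inner_sum_right sum_distrib_left mult_ac)
      also have "\<dots> = (\<Sum>i<n. \<Sum>j<n. c i * c j * (\<Sum>m\<in>idx N. r i m \<bullet> r j m))"
        unfolding sum_distrib_left
        by (subst sum.swap, intro sum.cong refl, rule sum.swap)
      also have "\<dots> = (\<Sum>i<n. \<Sum>j<n. if j = i then (r i k $ \<alpha>)\<^sup>2 / s i else 0)"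
      proof (intro sum.cong refl)
        fix i j assume ij: "i \<in> {..<n}" "j \<in> {..<n}"
        show "c i * c j * (\<Sum>m\<in>idx N. r i m \<bullet> r j m)
            = (if j = i then (r i k $ \<alpha>)\<^sup>2 / s i else 0)"
        proof (cases "j = i")
          case True
          then show ?thesis using s_pos[of i] ij
            by (simp add: c_def power2_eq_square flip: s_def)
        qed (use s_orth[of i j] ij in simp)
      qed
      finally show ?thesis by simp
    qed
    have zz: "(\<Sum>m\<in>idx N. z m \<bullet> z m) = 1"
    proof -
      have "(\<Sum>m\<in>idx N. z m \<bullet> z m) = (\<Sum>m\<in>idx N. if m = k then 1 else 0)"
        by (intro sum.cong refl) (simp add: z_def inner_axis')
      then show ?thesis using k by (simp add: finite_idx)
    qed
    have "0 \<le> (\<Sum>m\<in>idx N. (z m - w m) \<bullet> (z m - w m))"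
      by (intro sum_nonneg) auto
    also have "\<dots> = (\<Sum>m\<in>idx N. z m \<bullet> z m) - 2 * (\<Sum>m\<in>idx N. z m \<bullet> w m) + (\<Sum>m\<in>idx N. w m \<bullet> w m)"
    proof -
      have "(z m - w m) \<bullet> (z m - w m) = z m \<bullet> z m - 2 * (z m \<bullet> w m) + w m \<bullet> w m" for m
        by (simp add: inner_diff_left inner_diff_right inner_commute[of "w m" "z m"])
      then show ?thesis by (simp add: sum_subtractf sum.distrib sum_distrib_left)
    qed
    finally show ?thesis unfolding zw ww zz by simp
  qed
  have "real n = (\<Sum>i<n. s i / s i)"
    using s_pos by (simp add: less_imp_neq[symmetric])
  also have "\<dots> = (\<Sum>i<n. \<Sum>k\<in>idx N. \<Sum>\<alpha>\<in>UNIV. (r i k $ \<alpha>)\<^sup>2 / s i)"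
    by (intro sum.cong refl, subst (1) s_def)
      (simp add: inner_vec_def power2_eq_square sum_divide_distrib)
  also have "\<dots> = (\<Sum>k\<in>idx N. \<Sum>\<alpha>\<in>UNIV. \<Sum>i<n. (r i k $ \<alpha>)\<^sup>2 / s i)"
    by (subst sum.swap, intro sum.cong refl, rule sum.swap)
  also have "\<dots> \<le> (\<Sum>k\<in>idx N. \<Sum>\<alpha>\<in>(UNIV::'n set). 1)"
    by (intro sum_mono bessel)
  also have "\<dots> = real (card (idx N) * CARD('n))" by simp
  finally show ?thesis by (simp only: of_nat_le_iff)
qed

text \<open>\<open>V\<close> stands for \<open>Ebb\<close> and \<open>B\<close> for
  \<open>GA_mat\<close>. Symmetry and positivity are demanded on \<open>V\<close> alone, because
  \<open>B\<close> need not be symmetric elsewhere; membership in \<open>V\<close> therefore has to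
  be tracked throughout.\<close>

locale cg_on_subspace =
  fixes N :: "nat^'n" and B :: "(real, 'n) smat" and V :: "'n svec set" and b x0 :: "'n svec"
  assumes N_pos: "\<And>\<alpha>. N $ \<alpha> > 0"
    and V_supp: "\<And>v k. v \<in> V \<Longrightarrow> k \<notin> idx N \<Longrightarrow> v k = 0"
    and V_comb: "\<And>u v a. u \<in> V \<Longrightarrow> v \<in> V \<Longrightarrow> (\<lambda>k. u k + a *\<^sub>R v k) \<in> V"
    and V_B: "\<And>v. v \<in> V \<Longrightarrow> sapply N B v \<in> V"
    and B_sym: "\<And>u v. u \<in> V \<Longrightarrow> v \<in> V \<Longrightarrow> sdot N (sapply N B u) v = sdot N u (sapply N B v)"
    and B_pos: "\<And>v. v \<in> V \<Longrightarrow> v \<noteq> (\<lambda>_. 0) \<Longrightarrow> sdot N (sapply N B v) v > 0"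
    and b_V: "b \<in> V" and x0_V: "x0 \<in> V"
begin

definition x where "x i = cg_iterate (cg N B b x0 i)"
definition r where "r i = cg_residual (cg N B b x0 i)"
definition p where "p i = cg_direction (cg N B b x0 i)"

definition step_a where "step_a i = sdot N (r i) (r i) / sdot N (sapply N B (p i)) (p i)"
definition step_b where "step_b i = sdot N (r (Suc i)) (r (Suc i)) / sdot N (r i) (r i)"

lemma start:
  "x 0 = x0" "r 0 = (\<lambda>k. b k - sapply N B x0 k)" "p 0 = r 0"
  by (simp_all add: x_def r_def p_def cg_init_def cg_iterate_def cg_residual_def cg_direction_def Let_def)

lemma stopped:
  assumes "r i = (\<lambda>_. 0)"
  shows "x (Suc i) = x i" "r (Suc i) = r i" "p (Suc i) = p i"
  using assms by (simp_all add: x_def r_def p_def Let_def)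

lemma step:
  assumes "r i \<noteq> (\<lambda>_. 0)"
  shows "x (Suc i) = (\<lambda>k. x i k + step_a i *\<^sub>R p i k)"
    and "r (Suc i) = (\<lambda>k. r i k - step_a i *\<^sub>R sapply N B (p i) k)"
    and "p (Suc i) = (\<lambda>k. r (Suc i) k + step_b i *\<^sub>R p i k)"
proof -
  have *: "cg N B b x0 (Suc i) = cg_step N B (x i, r i, p i)"
    using assms by (simp add: x_def r_def p_def Let_def cg_iterate_def cg_residual_def cg_direction_def)
  show "x (Suc i) = (\<lambda>k. x i k + step_a i *\<^sub>R p i k)"
    unfolding x_def[of "Suc i"] * by (simp add: cg_step_def cg_iterate_def step_a_def Let_def)
  show r: "r (Suc i) = (\<lambda>k. r i k - step_a i *\<^sub>R sapply N B (p i) k)"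
    unfolding r_def[of "Suc i"] * by (simp add: cg_step_def cg_residual_def step_a_def Let_def)
  show "p (Suc i) = (\<lambda>k. r (Suc i) k + step_b i *\<^sub>R p i k)"
    unfolding p_def[of "Suc i"] * step_b_def r
    by (simp add: cg_step_def cg_direction_def step_a_def Let_def)
qed

lemma V_diff: "u \<in> V \<Longrightarrow> v \<in> V \<Longrightarrow> (\<lambda>k. u k - a *\<^sub>R v k) \<in> V"
  using V_comb[of u v "-a"] by simp

lemma in_V: "x i \<in> V \<and> r i \<in> V \<and> p i \<in> V"
proof (induction i)
  case 0
  have "r 0 \<in> V" using V_diff[OF b_V V_B[OF x0_V], of 1] by (simp add: start)
  then show ?case by (simp add: start x0_V)
next
  case (Suc i)
  show ?case
  proof (cases "r i = (\<lambda>_. 0)")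
    case False
    have "r (Suc i) \<in> V" using Suc by (simp add: step[OF False] V_diff V_B)
    then show ?thesis using Suc by (simp add: step(1,3)[OF False] V_comb)
  qed (use Suc stopped in simp)
qed

lemmas x_V = in_V[THEN conjunct1]
  and r_V = in_V[THEN conjunct2, THEN conjunct1]
  and p_V = in_V[THEN conjunct2, THEN conjunct2]

text \<open>By linearity of \<open>sapply\<close> the update of the residual mirrors that of the
  iterate. This turns a vanishing residual into a solution of the system.\<close>

lemma residual: "r i = (\<lambda>k. b k - sapply N B (x i) k)"
proof (induction i)
  case (Suc i)
  show ?case
  proof (cases "r i = (\<lambda>_. 0)")
    case False
    then show ?thesis unfolding step[OF False] sapply_add_scale
      using Suc by (simp add: diff_diff_eq)
  qed (use Suc stopped in simp)
qed (simp add: start)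

lemma nonzero_prefix: "r n \<noteq> (\<lambda>_. 0) \<Longrightarrow> i \<le> n \<Longrightarrow> r i \<noteq> (\<lambda>_. 0)"
proof (induction n)
  case (Suc n)
  then show ?case using stopped(2)[of n] by (cases "i = Suc n") auto
qed simp

lemma r_pos: "r i \<noteq> (\<lambda>_. 0) \<Longrightarrow> sdot N (r i) (r i) > 0"
  using sdot_pos[OF N_pos] V_supp[OF r_V] by blast

text \<open>The second hypothesis excludes a zero direction, which would force \<open>r i\<close> to
  have norm zero. It is supplied by the induction in \<open>orthogonality\<close>.\<close>

lemma Bp_pos:
  assumes "r i \<noteq> (\<lambda>_. 0)" "sdot N (r i) (p i) = sdot N (r i) (r i)"
  shows "sdot N (sapply N B (p i)) (p i) > 0"
proof -
  have "p i \<noteq> (\<lambda>_. 0)"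
  proof
    assume "p i = (\<lambda>_. 0)"
    then have "sdot N (r i) (p i) = 0" by (simp add: sdot_def)
    then show False using r_pos[OF assms(1)] assms(2) by simp
  qed
  then show ?thesis by (rule B_pos[OF p_V])
qed

text \<open>The three relations need each other and so share one induction: the first keeps the
  denominators positive, and orthogonality and conjugacy at one stage yield both at the next. Only
  residuals before \<open>n\<close> are assumed nonzero, so \<open>r n\<close> may already be the
  vanishing one.\<close>

lemma orthogonality:
  assumes "\<And>i. i < n \<Longrightarrow> r i \<noteq> (\<lambda>_. 0)"
  shows "(\<forall>j\<le>n. sdot N (r j) (p j) = sdot N (r j) (r j)) \<and>
    (\<forall>j\<le>n. \<forall>i<j. sdot N (r i) (r j) = 0 \<and> sdot N (sapply N B (p i)) (p j) = 0)"
  using assms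
proof (induction n)
  case 0
  then show ?case by (simp add: start)
next
  case (Suc n)
  have nz: "r i \<noteq> (\<lambda>_. 0)" if "i \<le> n" for i using Suc.prems that by simp
  note IH = Suc.IH[OF Suc.prems[OF less_SucI]]
  have rp: "sdot N (r j) (p j) = sdot N (r j) (r j)" if "j \<le> n" for j
    using IH that by blast
  have rr: "sdot N (r i) (r j) = 0" and BB: "sdot N (sapply N B (p i)) (p j) = 0"
    if "i < j" "j \<le> n" for i j
    using IH that by blast+
  have Bsym: "sdot N (sapply N B (p i)) (p j) = sdot N (sapply N B (p j)) (p i)" for i j
    using B_sym[OF p_V p_V, of i j] by (simp add: sdot_commute)
  have Bpos: "sdot N (sapply N B (p i)) (p i) > 0" if "i \<le> n" for i
    using Bp_pos[OF nz rp] that by simp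
  have a: "step_a i > 0" "step_a i * sdot N (sapply N B (p i)) (p i) = sdot N (r i) (r i)"
    if "i \<le> n" for i
    using Bpos[OF that] r_pos[OF nz[OF that]] by (simp_all add: step_a_def)
  \<comment> \<open>\<open>r i\<close> is \<open>p i\<close> minus a multiple of the preceding
    direction, and conjugacy removes that multiple; for \<open>i = 0\<close> the two vectors
    coincide.\<close>
  have Bp_r: "sdot N (sapply N B (p n)) (r i) = sdot N (sapply N B (p n)) (p i)" if "i \<le> n" for i
  proof (cases i)
    case (Suc j)
    have "sdot N (sapply N B (p n)) (p i) = sdot N (sapply N B (p n)) (r i)
        + step_b j * sdot N (sapply N B (p n)) (p j)"
      unfolding Suc by (subst step(3)) (use nz Suc that in \<open>auto simp: sdot_add_scale_right\<close>)
    moreover have "sdot N (sapply N B (p n)) (p j) = 0"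
      using BB[of j n] Bsym Suc that by simp
    ultimately show ?thesis by simp
  qed (simp add: start)
  \<comment> \<open>For \<open>i = n\<close> the choice of \<open>step_a n\<close> makes the two
    terms cancel; for \<open>i < n\<close> both vanish by induction, the second by way of
    \<open>Bp_r\<close>.\<close>
  have new_rr: "sdot N (r i) (r (Suc n)) = 0" if "i \<le> n" for i
  proof (cases "i = n")
    case True
    then show ?thesis using a(2)[of n] Bp_r[of n]
      by (simp add: step(2)[OF nz] sdot_diff_scale_right sdot_commute[of N "r n" "sapply N B (p n)"])
  next
    case False
    then have "i < n" using that by simp
    then show ?thesis using Bp_r[of i] rr[of i n] BB[of i n] Bsym[of i n]
      by (simp add: step(2)[OF nz] sdot_diff_scale_right sdot_commute[of N "r i" "sapply N B (p n)"])
  qed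
  \<comment> \<open>Read backwards, the residual update expresses \<open>sapply N B (p i)\<close> by
    two residuals, so conjugacy of the new direction reduces to orthogonality of residuals.\<close>
  have Bp_new: "step_a i * sdot N (sapply N B (p i)) (r (Suc n))
      = sdot N (r i) (r (Suc n)) - sdot N (r (Suc i)) (r (Suc n))" if "i \<le> n" for i
    by (simp add: step(2)[OF nz[OF that]] sdot_diff_scale_left)
  have new_BB: "sdot N (sapply N B (p i)) (p (Suc n)) = 0" if "i \<le> n" for i
  proof -
    have *: "sdot N (sapply N B (p i)) (p (Suc n))
        = sdot N (sapply N B (p i)) (r (Suc n)) + step_b n * sdot N (sapply N B (p i)) (p n)"
      by (simp add: step(3)[OF nz] sdot_add_scale_right)
    show ?thesis
    proof (cases "i = n")
      case True
      \<comment> \<open>The positive factor \<open>step_a n\<close> is divided out at the end. The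
        terms cancel because \<open>step_b n\<close> times the squared norm of \<open>r n\<close> is
        that of \<open>r (Suc n)\<close>.\<close>
      have "step_a n * sdot N (sapply N B (p n)) (p (Suc n)) = 
          - sdot N (r (Suc n)) (r (Suc n))
          + step_b n * (step_a n * sdot N (sapply N B (p n)) (p n))"
        using Bp_new[of n] new_rr[of n] *[unfolded True] by (simp add: algebra_simps)
      also have "\<dots> = 0"
        using r_pos[OF nz[of n]] by (simp add: a step_b_def)
      finally show ?thesis using a(1)[of n] True by simp
    next
      case False
      then have "i < n" using that by simp
      then have "step_a i * sdot N (sapply N B (p i)) (r (Suc n)) = 0"
        using Bp_new[of i] new_rr[of i] new_rr[of "Suc i"] by simp
      then have "sdot N (sapply N B (p i)) (r (Suc n)) = 0" using a(1)[OF that] by simp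
      then show ?thesis using * BB[of i n] \<open>i < n\<close> by simp
    qed
  qed
  have new_rp: "sdot N (r (Suc n)) (p (Suc n)) = sdot N (r (Suc n)) (r (Suc n))"
  proof -
    have "sdot N (r (Suc n)) (p n) = 0"
      using a(2)[of n] rp[of n] by (simp add: step(2)[OF nz] sdot_diff_scale_left)
    then show ?thesis by (subst step(3)) (use nz in \<open>simp_all add: sdot_add_scale_right\<close>)
  qed
  show ?case
  proof (intro conjI allI impI)
    fix j assume "j \<le> Suc n"
    then show "sdot N (r j) (p j) = sdot N (r j) (r j)"
      using rp new_rp by (cases "j = Suc n") auto
  next
    fix i j assume "j \<le> Suc n" "i < j"
    then show "sdot N (r i) (r j) = 0" "sdot N (sapply N B (p i)) (p j) = 0"
      using rr[of i j] BB[of i j] new_rr[of i] new_BB[of i] by (cases "j = Suc n"; simp)+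
  qed
qed

lemma step_ok:
  assumes "r i \<noteq> (\<lambda>_. 0)"
  shows "cg_step_ok N B (cg N B b x0 i)"
proof -
  have "sdot N (r i) (p i) = sdot N (r i) (r i)"
    using orthogonality[of i, OF nonzero_prefix[OF assms less_imp_le]] by blast
  then show ?thesis using Bp_pos[OF assms] r_pos[OF assms]
    by (simp add: cg_step_ok_def r_def p_def)
qed

lemma terminates: "\<exists>n. r n = (\<lambda>_. 0)"
proof (rule ccontr)
  assume "\<not> ?thesis"
  then have nz: "r i \<noteq> (\<lambda>_. 0)" for i by blast
  have less: "sdot N (r i) (r j) = 0" if "i < j" for i j
    using orthogonality[of j, OF nz] that by blast
  have "sdot N (r i) (r j) = 0" if "i \<noteq> j" for i j
  proof (cases "i < j")
    case False
    then have "sdot N (r j) (r i) = 0" using that by (intro less) simp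
    then show ?thesis by (simp only: sdot_commute)
  qed (rule less)
  then have "n \<le> card (idx N) * CARD('n)" for n
    using orthogonal_family_card[OF N_pos, of n r] r_pos[OF nz] by blast
  from this[of "Suc (card (idx N) * CARD('n))"] show False by simp
qed

text \<open>Positivity excludes a nonzero kernel vector in \<open>V\<close>. The factor 1 in
  \<open>w\<close> only brings the difference into the form of \<open>V_diff\<close>.\<close>

lemma solution_unique:
  assumes "u \<in> V" "v \<in> V" "sapply N B u = sapply N B v"
  shows "u = v"
proof (rule ccontr)
  assume "u \<noteq> v"
  define w where "w = (\<lambda>k. u k - 1 *\<^sub>R v k)"
  have "w \<in> V" unfolding w_def by (intro V_diff assms)
  moreover have "w \<noteq> (\<lambda>_. 0)" using \<open>u \<noteq> v\<close> by (auto simp: w_def fun_eq_iff)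
  moreover have "sapply N B w = (\<lambda>_. 0)"
    using sapply_add_scale[of N B u "-1" v] assms(3) by (simp add: w_def)
  ultimately have "sdot N (\<lambda>_. 0) w > 0" using B_pos[of w] by simp
  then show False by (simp add: sdot_def)
qed

text \<open>Solvability in \<open>V\<close> is a by-product of termination: an iterate with
  vanishing residual is the solution.\<close>

lemma solves:
  "(\<forall>i. cg_residual (cg N B b x0 i) \<noteq> (\<lambda>_. 0) \<longrightarrow> cg_step_ok N B (cg N B b x0 i)) \<and>
    (\<exists>e. e \<in> V \<and> sapply N B e = b \<and>
         (\<forall>e'\<in>V. sapply N B e' = b \<longrightarrow> e' = e) \<and>
         (\<exists>n. cg_residual (cg N B b x0 n) = (\<lambda>_. 0) \<and> cg_iterate (cg N B b x0 n) = e))"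
proof -
  obtain n where n: "r n = (\<lambda>_. 0)" using terminates by blast
  have sol: "sapply N B (x n) = b"
  proof
    fix k
    have "r n k = b k - sapply N B (x n) k" by (subst residual) (rule refl)
    then show "sapply N B (x n) k = b k" unfolding n by simp
  qed
  have "cg_residual (cg N B b x0 n) = (\<lambda>_. 0) \<and> cg_iterate (cg N B b x0 n) = x n"
    using n unfolding r_def x_def by (rule conjI) (rule refl)
  moreover have "\<forall>e'\<in>V. sapply N B e' = b \<longrightarrow> e' = x n"
    using solution_unique[OF _ x_V] sol by metis
  moreover have "\<forall>i. cg_residual (cg N B b x0 i) \<noteq> (\<lambda>_. 0) \<longrightarrow> cg_step_ok N B (cg N B b x0 i)"
    unfolding r_def[symmetric] using step_ok by blast
  ultimately show ?thesis using sol x_V[of n] by blast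
qed

end

section \<open>The discrete Fourier transform\<close>

text \<open>Half of an odd entry is not an integer, so the half-open range of the definition is a
  symmetric closed one.\<close>

lemma idx_odd:
  assumes "\<And>\<alpha>. odd (N $ \<alpha>)"
  shows "k \<in> idx N \<longleftrightarrow> (\<forall>\<alpha>. k $ \<alpha> \<in> {- int (N $ \<alpha> div 2) .. int (N $ \<alpha> div 2)})"
proof -
  have "(- (real (N $ \<alpha>) / 2) \<le> of_int (k $ \<alpha>) \<and> of_int (k $ \<alpha>) < real (N $ \<alpha>) / 2)
      \<longleftrightarrow> k $ \<alpha> \<in> {- int (N $ \<alpha> div 2) .. int (N $ \<alpha> div 2)}" for \<alpha>
  proof -
    obtain j where j: "N $ \<alpha> = 2 * j + 1" using assms oddE by blast
    have "(- (real (N $ \<alpha>) / 2) \<le> of_int (k $ \<alpha>) \<and> of_int (k $ \<alpha>) < real (N $ \<alpha>) / 2)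
      \<longleftrightarrow> real_of_int (- (2 * int j + 1)) \<le> real_of_int (2 * k $ \<alpha>)
        \<and> real_of_int (2 * k $ \<alpha>) < real_of_int (2 * int j + 1)"
      by (simp add: j field_simps)
    also have "\<dots> \<longleftrightarrow> - (2 * int j + 1) \<le> 2 * k $ \<alpha> \<and> 2 * k $ \<alpha> < 2 * int j + 1"
      by (simp only: of_int_le_iff of_int_less_iff)
    also have "\<dots> \<longleftrightarrow> k $ \<alpha> \<in> {- int (N $ \<alpha> div 2) .. int (N $ \<alpha> div 2)}"
      using j by auto
    finally show ?thesis .
  qed
  then show ?thesis by (simp add: idx_def)
qed

text \<open>A geometric sum with ratio \<open>q\<close>. Oddness gives the symmetric window exactly
  \<open>n\<close> integers; the bound on \<open>t\<close> excludes \<open>q = 1\<close> for nonzero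
  \<open>t\<close>, since \<open>n\<close> would have to divide \<open>t\<close>.\<close>

lemma sum_roots_of_unity:
  fixes n :: nat and t :: int
  assumes "odd n" "\<bar>t\<bar> < int n"
  shows "(\<Sum>k\<in>{- int (n div 2)..int (n div 2)}.
      exp (2 * of_real pi * \<i> * (of_int k * of_int t / of_nat n))) = (if t = 0 then of_nat n else 0)"
proof -
  obtain j where j: "n = 2 * j + 1" using assms(1) oddE by blast
  define q where "q = exp (2 * of_real pi * \<i> * (of_int t / of_nat n))"
  \<comment> \<open>Shifting the window by \<open>j\<close> makes it start at zero and costs a
    factor that does not depend on the summation index.\<close>
  have "(\<Sum>k\<in>{- int (n div 2)..int (n div 2)}. exp (2 * of_real pi * \<i> * (of_int k * of_int t / of_nat n)))
      = (\<Sum>i<n. exp (2 * of_real pi * \<i> * (of_int (int i - int j) * of_int t / of_nat n)))"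
    by (rule sum.reindex_bij_witness[of _ "\<lambda>i. int i - int j" "\<lambda>k. nat (k + int j)"])
      (auto simp: j)
  also have "\<dots> = (\<Sum>i<n. exp (- (2 * of_real pi * \<i> * (of_nat j * of_int t / of_nat n))) * q ^ i)"
  proof (intro sum.cong refl)
    fix i
    have "2 * of_real pi * \<i> * (of_int (int i - int j) * of_int t / of_nat n)
      = - (2 * of_real pi * \<i> * (of_nat j * of_int t / of_nat n))
        + of_nat i * (2 * of_real pi * \<i> * (of_int t / of_nat n))"
      by (simp add: ring_distribs diff_divide_distrib mult_ac)
    then show "exp (2 * of_real pi * \<i> * (of_int (int i - int j) * of_int t / of_nat n))
      = exp (- (2 * of_real pi * \<i> * (of_nat j * of_int t / of_nat n))) * q ^ i"
      by (simp only: exp_add exp_of_nat_mult q_def)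
  qed
  also have "\<dots> = exp (- (2 * of_real pi * \<i> * (of_nat j * of_int t / of_nat n))) * (\<Sum>i<n. q ^ i)"
    by (simp add: sum_distrib_left)
  also have "\<dots> = (if t = 0 then of_nat n else 0)"
  proof (cases "t = 0")
    case False
    have "q \<noteq> 1"
    proof
      assume "q = 1"
      then obtain m :: int where "2 * pi * (real_of_int t / real n) = of_int (2 * m) * pi"
        unfolding q_def exp_eq_1 by auto
      then have "pi * (2 * (real_of_int t / real n)) = pi * (2 * of_int m)" by (simp add: mult_ac)
      then have "2 * (real_of_int t / real n) = 2 * of_int m"
        by (simp only: mult_left_cancel[OF pi_neq_zero])
      then have "real_of_int t / real n = of_int m" by linarith
      then have "real_of_int t = of_int m * real n"
        using j by (simp add: divide_eq_eq)
      then have "t = m * int n"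
        by (metis of_int_eq_iff of_int_mult of_int_of_nat_eq)
      then show False using assms(2) False
        by (metis dvd_triv_right zdvd_imp_le zero_less_abs_iff dvd_abs_iff not_le)
    qed
    moreover have "q ^ n = 1"
    proof -
      have "q ^ n = exp (of_nat n * (2 * of_real pi * \<i> * (of_int t / of_nat n)))"
        by (simp only: q_def exp_of_nat_mult)
      also have "of_nat n * (2 * of_real pi * \<i> * (of_int t / of_nat n)) = 2 * of_int t * of_real pi * \<i>"
        using odd_pos[OF assms(1)] by simp
      also have "exp \<dots> = 1" by (simp add: exp_eq_1)
      finally show ?thesis .
    qed
    ultimately have "(\<Sum>i<n. q ^ i) = 0" by (simp add: geometric_sum)
    then show ?thesis using False by simp
  qed (simp add: q_def)
  finally show ?thesis .
qed

lemma omega_add: "omega N k (l + m) = omega N k l * omega N k m"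
  by (simp add: omega_def sum.distrib ring_distribs add_divide_distrib exp_add)

lemma omega_commute: "omega N k l = omega N l k"
  by (simp add: omega_def mult.commute)

text \<open>\<open>omega\<close> is a product over coordinates, so the sum over the box of
  multi-indices factors into one-dimensional sums. Two frequencies in \<open>idx N\<close> differ by
  less than \<open>N\<close> in every coordinate, which rules out aliasing.\<close>

lemma sum_omega:
  fixes N :: "nat^'n"
  assumes N: "\<And>\<alpha>. odd (N $ \<alpha>)" and l: "l \<in> idx N" and m: "m \<in> idx N"
  shows "(\<Sum>k\<in>idx N. omega N k (l - m)) = (if l = m then of_nat (\<Prod>\<alpha>\<in>UNIV. N $ \<alpha>) else 0)"
proof -
  let ?S = "\<lambda>\<alpha>. {- int (N $ \<alpha> div 2)..int (N $ \<alpha> div 2)}"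
  let ?e = "\<lambda>\<alpha> k. exp (2 * complex_of_real pi * \<i> * (of_int k * of_int ((l - m) $ \<alpha>) / of_nat (N $ \<alpha>)))"
  have "(\<Sum>k\<in>idx N. omega N k (l - m)) = (\<Sum>k\<in>idx N. \<Prod>\<alpha>\<in>UNIV. ?e \<alpha> (k $ \<alpha>))"
    by (simp add: omega_def sum_distrib_left exp_sum)
  also have "\<dots> = (\<Sum>g\<in>PiE UNIV ?S. \<Prod>\<alpha>\<in>UNIV. ?e \<alpha> (g \<alpha>))"
    by (rule sum.reindex_bij_witness[of _ vec_lambda vec_nth])
      (auto simp: idx_odd[OF N] PiE_iff extensional_def)
  also have "\<dots> = (\<Prod>\<alpha>\<in>UNIV. \<Sum>k\<in>?S \<alpha>. ?e \<alpha> k)"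
    by (rule prod_sum_PiE[symmetric]) auto
  also have "\<dots> = (\<Prod>\<alpha>\<in>UNIV. if (l - m) $ \<alpha> = 0 then of_nat (N $ \<alpha>) else 0)"
  proof (intro prod.cong refl sum_roots_of_unity N)
    fix \<alpha>
    obtain j where "N $ \<alpha> = 2 * j + 1" using N oddE by blast
    then show "\<bar>(l - m) $ \<alpha>\<bar> < int (N $ \<alpha>)"
      using l m by (auto simp: idx_odd[OF N] dest!: spec[of _ \<alpha>])
  qed
  also have "\<dots> = (if l = m then of_nat (\<Prod>\<alpha>\<in>UNIV. N $ \<alpha>) else 0)"
    by (auto simp: vec_eq_iff prod_zero_iff)
  finally show ?thesis .
qed

text \<open>The blocks of \<open>F_mat\<close> are multiples of the identity, so it treats each
  component separately; this is its action on one of them.\<close>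

definition dft :: "nat^'n \<Rightarrow> (int^'n \<Rightarrow> complex) \<Rightarrow> int^'n \<Rightarrow> complex" where
  "dft N f l = (\<Sum>m\<in>idx N. omega N (- l) m * f m) / of_nat (\<Prod>\<alpha>\<in>UNIV. N $ \<alpha>)"

text \<open>Orthogonality of the columns of \<open>omega\<close> singles out one coefficient.
  Coefficients can therefore be compared through values at the grid points.\<close>

lemma dft_inverse:
  assumes N: "\<And>\<alpha>. odd (N $ \<alpha>)" and l: "l \<in> idx N"
    and f: "\<And>k. k \<in> idx N \<Longrightarrow> f k = (\<Sum>m\<in>idx N. c m * omega N k m)"
  shows "dft N f l = c l"
proof -
  have pos: "(\<Prod>\<alpha>\<in>UNIV. N $ \<alpha>) \<noteq> 0" using N by (auto simp: prod_zero_iff dest: odd_pos)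
  have "(\<Sum>k\<in>idx N. omega N (- l) k * f k)
      = (\<Sum>k\<in>idx N. \<Sum>m\<in>idx N. c m * omega N k (m - l))"
  proof (intro sum.cong refl)
    fix k assume k: "k \<in> idx N"
    have "omega N (- l) k * omega N k m = omega N k (m - l)" for m
      using omega_add[of N k m "- l"] omega_commute[of N "- l" k] by (simp add: mult.commute)
    then show "omega N (- l) k * f k = (\<Sum>m\<in>idx N. c m * omega N k (m - l))"
      by (simp add: f[OF k] sum_distrib_left mult.left_commute)
  qed
  also have "\<dots> = (\<Sum>m\<in>idx N. c m * (\<Sum>k\<in>idx N. omega N k (m - l)))"
    by (subst sum.swap) (simp add: sum_distrib_left)
  also have "\<dots> = (\<Sum>m\<in>idx N. if m = l then c l * of_nat (\<Prod>\<alpha>\<in>UNIV. N $ \<alpha>) else 0)"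
    by (intro sum.cong refl) (simp add: sum_omega[OF N _ l])
  also have "\<dots> = c l * of_nat (\<Prod>\<alpha>\<in>UNIV. N $ \<alpha>)"
    using l by (simp add: finite_idx)
  finally show ?thesis using pos by (simp add: dft_def del: of_nat_prod)
qed

lemma dft_uminus:
  fixes f :: "int^'n \<Rightarrow> real"
  shows "dft N (\<lambda>k. of_real (f k)) (- l) = cnj (dft N (\<lambda>k. of_real (f k)) l)"
proof -
  have "cnj (omega N k m) = omega N (- k) m" for k m
    by (simp add: omega_def exp_cnj sum_negf)
  then show ?thesis by (simp add: dft_def)
qed

text \<open>Exchanging the sums leaves \<open>Finv_mat\<close> as synthesis from filtered
  coefficients. Both inclusions between \<open>Ebb\<close> and the range of \<open>G_mat\<close>
  compare coefficients through this formula.\<close>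

lemma sapply_G_mat:
  fixes N :: "nat^'a"
  assumes N: "\<And>\<alpha>. odd (N $ \<alpha>)" and k: "k \<in> idx N"
  shows "complex_of_real (sapply N (G_mat Y N) v k $ \<alpha>)
    = (\<Sum>l\<in>idx N. (\<Sum>\<beta>\<in>UNIV. of_real (Ghat_mat Y l l $ \<alpha> $ \<beta>)
          * dft N (\<lambda>m. of_real (v m $ \<beta>)) l) * omega N k l)"
proof -
  have G: "complex_of_real (G_mat Y N k m $ \<alpha> $ \<beta>) = Gc_mat Y N k m $ \<alpha> $ \<beta>" for m \<beta>
    using G_mat_real[OF N, of Y k m] by (simp add: vec_eq_iff)
  have "complex_of_real (sapply N (G_mat Y N) v k $ \<alpha>)
      = (\<Sum>m\<in>idx N. \<Sum>\<beta>\<in>UNIV. Gc_mat Y N k m $ \<alpha> $ \<beta> * of_real (v m $ \<beta>))"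
    using k by (simp add: sapply_def svec_of_def sum_component matrix_vector_mult_def G)
  also have "\<dots> = (\<Sum>m\<in>idx N. \<Sum>\<beta>\<in>UNIV. \<Sum>l\<in>idx N. of_real (Ghat_mat Y l l $ \<alpha> $ \<beta>)
      * (omega N (- l) m * of_real (v m $ \<beta>) / of_nat (\<Prod>\<gamma>\<in>UNIV. N $ \<gamma>)) * omega N k l)"
    unfolding Gc_mat_entry sum_distrib_right
    by (intro sum.cong refl) (simp add: mult_ac del: of_nat_prod)
  also have "\<dots> = (\<Sum>l\<in>idx N. \<Sum>\<beta>\<in>UNIV. \<Sum>m\<in>idx N. of_real (Ghat_mat Y l l $ \<alpha> $ \<beta>)
      * (omega N (- l) m * of_real (v m $ \<beta>) / of_nat (\<Prod>\<gamma>\<in>UNIV. N $ \<gamma>)) * omega N k l)"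
  proof -
    have swap: "(\<Sum>m\<in>S. \<Sum>\<beta>\<in>T. \<Sum>l\<in>S. h m \<beta> l) = (\<Sum>l\<in>S. \<Sum>\<beta>\<in>T. \<Sum>m\<in>S. h m \<beta> l)"
      for S :: "(int^'a) set" and T :: "'a set" and h :: "int^'a \<Rightarrow> 'a \<Rightarrow> int^'a \<Rightarrow> complex"
    proof -
      have "(\<Sum>m\<in>S. \<Sum>\<beta>\<in>T. \<Sum>l\<in>S. h m \<beta> l) = (\<Sum>\<beta>\<in>T. \<Sum>m\<in>S. \<Sum>l\<in>S. h m \<beta> l)"
        by (rule sum.swap)
      also have "\<dots> = (\<Sum>\<beta>\<in>T. \<Sum>l\<in>S. \<Sum>m\<in>S. h m \<beta> l)"
        by (intro sum.cong refl sum.swap)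
      also have "\<dots> = (\<Sum>l\<in>S. \<Sum>\<beta>\<in>T. \<Sum>m\<in>S. h m \<beta> l)"
        by (rule sum.swap)
      finally show ?thesis .
    qed
    show ?thesis by (rule swap)
  qed
  also have "\<dots> = (\<Sum>l\<in>idx N. (\<Sum>\<beta>\<in>UNIV. of_real (Ghat_mat Y l l $ \<alpha> $ \<beta>)
          * dft N (\<lambda>m. of_real (v m $ \<beta>)) l) * omega N k l)"
    by (simp add: dft_def sum_distrib_left sum_distrib_right sum_divide_distrib del: of_nat_prod)
  finally show ?thesis .
qed

text \<open>Replacing \<open>l\<close> by \<open>- l\<close> in the frequency sum exchanges
  \<open>k\<close> and \<open>m\<close>, while \<open>Ghat_mat\<close> is even in \<open>l\<close>
  and symmetric. This is what makes the projection orthogonal.\<close>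

lemma G_mat_transpose:
  assumes N: "\<And>\<alpha>. odd (N $ \<alpha>)"
  shows "transpose (G_mat Y N k m) = G_mat Y N m k"
proof -
  have freq: "freq Y (- l) = - freq Y l" for l by (simp add: freq_def vec_eq_iff)
  have Ghat: "Ghat_mat Y (- l) (- l) $ \<beta> $ \<alpha> = Ghat_mat Y l l $ \<alpha> $ \<beta>" for l \<alpha> \<beta>
    by (simp add: Ghat_mat_def freq mult.commute)
  have "Gc_mat Y N k m $ \<beta> $ \<alpha> = Gc_mat Y N m k $ \<alpha> $ \<beta>" for \<alpha> \<beta>
  proof -
    let ?P = "complex_of_nat (\<Prod>\<gamma>\<in>UNIV. N $ \<gamma>)"
    have "Gc_mat Y N k m $ \<beta> $ \<alpha>
        = (\<Sum>l\<in>idx N. omega N k (- l) * of_real (Ghat_mat Y l l $ \<alpha> $ \<beta>) * (omega N l m / ?P))"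
      unfolding Gc_mat_entry
      by (rule sum.reindex_bij_witness[of _ uminus uminus])
        (simp_all add: idx_uminus N Ghat del: of_nat_prod)
    also have "\<dots> = Gc_mat Y N m k $ \<alpha> $ \<beta>"
      unfolding Gc_mat_entry
    proof (intro sum.cong refl)
      fix l
      show "omega N k (- l) * of_real (Ghat_mat Y l l $ \<alpha> $ \<beta>) * (omega N l m / ?P)
          = omega N m l * of_real (Ghat_mat Y l l $ \<alpha> $ \<beta>) * (omega N (- l) k / ?P)"
        unfolding omega_commute[of N k "- l"] omega_commute[of N l m] by (simp add: mult_ac del: of_nat_prod)
    qed
    finally show ?thesis .
  qed
  then show ?thesis by (simp add: G_mat_def vec_eq_iff transpose_def)
qed

lemma sapply_G_mat_symmetric:
  assumes N: "\<And>\<alpha>. odd (N $ \<alpha>)"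
  shows "sdot N (sapply N (G_mat Y N) u) v = sdot N u (sapply N (G_mat Y N) v)"
proof -
  have "(\<Sum>k\<in>idx N. sapply N (G_mat Y N) u k \<bullet> v k)
      = (\<Sum>k\<in>idx N. \<Sum>m\<in>idx N. (G_mat Y N k m *v u m) \<bullet> v k)"
    by (simp add: sapply_def svec_of_def inner_sum_left)
  also have "\<dots> = (\<Sum>k\<in>idx N. \<Sum>m\<in>idx N. u m \<bullet> (G_mat Y N m k *v v k))"
  proof (intro sum.cong refl)
    fix k m
    have "v k \<bullet> (G_mat Y N k m *v u m) = (v k v* G_mat Y N k m) \<bullet> u m"
      by (rule dot_lmul_matrix[symmetric])
    also have "v k v* G_mat Y N k m = G_mat Y N m k *v v k"
      by (simp only: transpose_matrix_vector[symmetric] G_mat_transpose[OF N])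
    finally show "(G_mat Y N k m *v u m) \<bullet> v k = u m \<bullet> (G_mat Y N m k *v v k)"
      by (metis inner_commute)
  qed
  also have "\<dots> = (\<Sum>m\<in>idx N. u m \<bullet> sapply N (G_mat Y N) v m)"
    by (subst sum.swap) (simp add: sapply_def svec_of_def inner_sum_right)
  finally show ?thesis by (simp add: sdot_def)
qed

text \<open>The half-periods cancel between frequency and grid point, so the discrete transform does
  not see the size of the cell.\<close>

lemma four_grid:
  assumes "\<And>\<alpha>. Y $ \<alpha> > 0"
  shows "four Y l (grid Y N k) = omega N k l"
proof -
  have "Y $ \<alpha> \<noteq> 0" for \<alpha> using assms[of \<alpha>] by simp
  then have "of_int (l $ \<alpha>) / Y $ \<alpha> * (of_int (k $ \<alpha>) * (2 * Y $ \<alpha> / real (N $ \<alpha>)))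
      = 2 * (of_int (k $ \<alpha>) * of_int (l $ \<alpha>) / real (N $ \<alpha>))" for \<alpha>
    by simp
  then have "freq Y l \<bullet> grid Y N k = 2 * (\<Sum>\<alpha>\<in>UNIV. of_int (k $ \<alpha>) * of_int (l $ \<alpha>) / real (N $ \<alpha>))"
    by (simp only: freq_def grid_def inner_vec_def sum_distrib_left vec_lambda_beta inner_real_def)
  then show ?thesis by (simp add: four_def omega_def mult_ac)
qed

section \<open>Integration of periodic functions over the cell\<close>

text \<open>The box from \<open>- Y\<close> to \<open>Y + axis \<alpha> s\<close> is cut in two
  ways: into the cell and a final slab, or into an initial slab and the shifted cell. The slabs
  differ by one period and carry equal integrals.\<close>

lemma integral_shift_periodic:
  fixes f :: "real^'n \<Rightarrow> real"
  assumes Y: "\<And>\<beta>. Y $ \<beta> > 0" and per: "periodic Y f" and cont: "continuous_on UNIV f"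
    and s: "0 \<le> s" "s \<le> 2 * Y $ \<alpha>"
  shows "integral (cell Y) (\<lambda>x. f (x + axis \<alpha> s)) = integral (cell Y) f"
proof -
  define T where "T = axis \<alpha> (2 * Y $ \<alpha>)"
  define e where "e = axis \<alpha> s"
  have int: "f integrable_on cbox (- Y) (Y + e)"
    by (rule integrable_continuous) (rule continuous_on_subset[OF cont], simp)
  have split: "integral (cbox (- Y) (Y + e)) f =
      integral (cbox (- Y) (Y + e) \<inter> {x. x \<bullet> axis \<alpha> 1 \<le> c}) f +
      integral (cbox (- Y) (Y + e) \<inter> {x. x \<bullet> axis \<alpha> 1 \<ge> c}) f" for c
    by (rule integral_split[OF int]) (simp add: axis_in_Basis_iff)
  have Ya: "- Y $ \<alpha> \<le> Y $ \<alpha>" using Y[of \<alpha>] by simp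
  have eq: "cbox (- Y) (Y + e) \<inter> {x. x \<bullet> axis \<alpha> 1 \<le> Y $ \<alpha>} = cbox (- Y) Y"
      "cbox (- Y) (Y + e) \<inter> {x. x \<bullet> axis \<alpha> 1 \<ge> Y $ \<alpha>} = cbox (- Y + T) (Y + e)"
      "cbox (- Y) (Y + e) \<inter> {x. x \<bullet> axis \<alpha> 1 \<le> - Y $ \<alpha> + s} = cbox (- Y) (Y + e - T)"
      "cbox (- Y) (Y + e) \<inter> {x. x \<bullet> axis \<alpha> 1 \<ge> - Y $ \<alpha> + s} = cbox (- Y + e) (Y + e)"
  proof -
    have comp: "x \<bullet> axis \<alpha> 1 = x $ \<alpha>" for x :: "real^'n" by (simp add: inner_axis)
    have T_e: "T $ i = (if i = \<alpha> then 2 * Y $ \<alpha> else 0)" "e $ i = (if i = \<alpha> then s else 0)" for i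
      by (simp_all add: T_def e_def axis_def)
    have all: "(\<forall>i. P i) \<longleftrightarrow> P \<alpha> \<and> (\<forall>i. i \<noteq> \<alpha> \<longrightarrow> P i)" for P by metis
    show "cbox (- Y) (Y + e) \<inter> {x. x \<bullet> axis \<alpha> 1 \<le> Y $ \<alpha>} = cbox (- Y) Y"
      "cbox (- Y) (Y + e) \<inter> {x. x \<bullet> axis \<alpha> 1 \<ge> Y $ \<alpha>} = cbox (- Y + T) (Y + e)"
      "cbox (- Y) (Y + e) \<inter> {x. x \<bullet> axis \<alpha> 1 \<le> - Y $ \<alpha> + s} = cbox (- Y) (Y + e - T)"
      "cbox (- Y) (Y + e) \<inter> {x. x \<bullet> axis \<alpha> 1 \<ge> - Y $ \<alpha> + s} = cbox (- Y + e) (Y + e)"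
      using s Ya unfolding set_eq_iff Int_iff mem_Collect_eq mem_box_cart comp
        all[of "\<lambda>i. _ i \<and> _ i"]
      by (auto simp: T_e)
  qed
  have "integral (cbox (- Y + T) (Y + e)) f = integral (cbox (- Y) (Y + e - T)) (\<lambda>x. f (x + T))"
    using integral_shift_cbox[of "- Y + T" T "Y + e" f] by simp
  also have "(\<lambda>x. f (x + T)) = f" using per by (auto simp: periodic_def T_def)
  finally have "integral (cbox (- Y + e) (Y + e)) f = integral (cbox (- Y) Y) f"
    using split[of "Y $ \<alpha>"] split[of "- Y $ \<alpha> + s"] unfolding eq by simp
  then show ?thesis
    using integral_shift_cbox[of "- Y + e" e "Y + e" f] by (simp add: cell_def e_def)
qed

lemma has_vector_derivative_pderiv_at:
  fixes f :: "real^'n \<Rightarrow> real"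
  assumes "\<And>x. f differentiable (at x)"
  shows "((\<lambda>s. f (x + axis \<alpha> s)) has_vector_derivative pderiv_at \<alpha> f (x + axis \<alpha> s)) (at s within U)"
proof -
  let ?f' = "frechet_derivative f (at (x + axis \<alpha> s))"
  have f: "(f has_derivative ?f') (at (x + axis \<alpha> s))"
    using assms by (simp add: frechet_derivative_works)
  define u :: "real^'n" where "u = axis \<alpha> 1"
  have ax: "axis \<alpha> t = t *\<^sub>R u" for t
    by (simp add: vec_eq_iff axis_def u_def)
  have g: "((\<lambda>t. x + axis \<alpha> t) has_derivative (\<lambda>h. h *\<^sub>R u)) (at s within U)"
    unfolding ax by (auto intro!: derivative_eq_intros)
  have "((\<lambda>t. f (x + axis \<alpha> t)) has_derivative (\<lambda>h. ?f' (h *\<^sub>R u))) (at s within U)"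
    by (rule has_derivative_compose[OF g f])
  moreover have "?f' (h *\<^sub>R u) = h *\<^sub>R ?f' u" for h
    by (rule linear_cmul[OF has_derivative_linear[OF f]])
  ultimately show ?thesis by (simp add: has_vector_derivative_def pderiv_at_def u_def)
qed

text \<open>The integral over a shifted cell does not depend on the shift; differentiate at shift zero.\<close>

lemma integral_pderiv_periodic:
  fixes f :: "real^'n \<Rightarrow> real"
  assumes Y: "\<And>\<beta>. Y $ \<beta> > 0" and per: "periodic Y f"
    and diff: "\<And>x. f differentiable (at x)" and cont': "continuous_on UNIV (pderiv_at \<alpha> f)"
  shows "integral (cell Y) (pderiv_at \<alpha> f) = 0"
proof -
  \<comment> \<open>The shift lemma covers shifts from zero to one period, so zero is an endpoint
    and the derivatives below are one-sided.\<close>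
  let ?U = "cbox 0 (2 * Y $ \<alpha>)"
  have cont: "continuous_on UNIV f"
    using diff by (simp add: continuous_at_imp_continuous_on differentiable_imp_continuous_within)
  define u :: "real^'n" where "u = axis \<alpha> 1"
  have ax: "axis \<alpha> t = t *\<^sub>R u" for t
    by (simp add: vec_eq_iff axis_def u_def)
  have "((\<lambda>s. integral (cbox (- Y) Y) (\<lambda>x. f (x + axis \<alpha> s))) has_vector_derivative
      integral (cbox (- Y) Y) (\<lambda>x. pderiv_at \<alpha> f (x + axis \<alpha> 0))) (at 0 within ?U)"
  proof (rule leibniz_rule_vector_derivative)
    show "((\<lambda>s. f (x + axis \<alpha> s)) has_vector_derivative pderiv_at \<alpha> f (x + axis \<alpha> s)) (at s within ?U)"
      for s x by (rule has_vector_derivative_pderiv_at[OF diff])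
    show "(\<lambda>x. f (x + axis \<alpha> s)) integrable_on cbox (- Y) Y" for s
      by (rule integrable_continuous) (intro continuous_on_compose2[OF cont] continuous_intros, simp)
    show "continuous_on (?U \<times> cbox (- Y) Y) (\<lambda>(s, x). pderiv_at \<alpha> f (x + axis \<alpha> s))"
      unfolding ax split_beta
      by (intro continuous_on_compose2[OF cont'] continuous_intros) simp
    show "0 \<in> ?U" using Y[of \<alpha>] by simp
  qed simp
  moreover have "((\<lambda>s. integral (cbox (- Y) Y) (\<lambda>x. f (x + axis \<alpha> s))) has_vector_derivative 0)
      (at 0 within ?U)"
    by (rule has_vector_derivative_transform[of _ _ _ "\<lambda>_. integral (cell Y) f"])
      (use Y[of \<alpha>] integral_shift_periodic[OF Y per cont] in \<open>auto simp: cell_def\<close>)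
  ultimately have "integral (cbox (- Y) Y) (\<lambda>x. pderiv_at \<alpha> f (x + axis \<alpha> 0)) = 0"
    using Y[of \<alpha>] by (intro vector_derivative_unique_within_closed_interval[of 0 "2 * Y $ \<alpha>" 0]) auto
  then show ?thesis by (simp add: cell_def ax)
qed

section \<open>Integrability on the cell and integration by parts\<close>

lemma set_integrable_continuous_cell:
  fixes f :: "real^'n \<Rightarrow> 'a::euclidean_space"
  assumes "continuous_on UNIV f"
  shows "set_integrable lebesgue (cell Y) f"
  unfolding cell_def
  by (intro absolutely_integrable_continuous continuous_on_subset[OF assms]) simp

lemma set_lebesgue_integral_continuous_cell:
  fixes f :: "real^'n \<Rightarrow> 'a::euclidean_space"
  assumes "continuous_on UNIV f"
  shows "(LINT x:cell Y|lebesgue. f x) = integral (cell Y) f"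
  by (rule set_lebesgue_integral_eq_integral(2)[OF set_integrable_continuous_cell[OF assms]])

lemma Cinf_perD:
  assumes "\<phi> \<in> Cinf_per Y"
  shows "periodic Y \<phi>" "\<phi> differentiable (at x)" "continuous_on UNIV \<phi>"
    "continuous_on UNIV (pderiv_at \<alpha> \<phi>)"
proof -
  have "\<And>j. Ck j \<phi>" using assms by (simp add: Cinf_per_def)
  from this[of 0] this[of 1] show "\<phi> differentiable (at x)" "continuous_on UNIV \<phi>"
    "continuous_on UNIV (pderiv_at \<alpha> \<phi>)" by simp_all
qed (use assms in \<open>simp add: Cinf_per_def\<close>)

lemma pderiv_at_mult:
  assumes "f differentiable (at x)" "g differentiable (at x)"
  shows "pderiv_at \<alpha> (\<lambda>x. f x * g x) x = f x * pderiv_at \<alpha> g x + pderiv_at \<alpha> f x * g x"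
proof -
  have "((\<lambda>x. f x * g x) has_derivative (\<lambda>h. f x * frechet_derivative g (at x) h
      + frechet_derivative f (at x) h * g x)) (at x)"
    using assms by (intro has_derivative_mult) (simp_all add: frechet_derivative_works)
  then show ?thesis by (simp add: pderiv_at_def flip: frechet_derivative_at)
qed

text \<open>The product is again periodic, so the integral of its derivative vanishes and the
  product rule gives the rest.\<close>

lemma integral_by_parts_cell:
  fixes v \<phi> :: "real^'n \<Rightarrow> real"
  assumes Y: "\<And>\<beta>. Y $ \<beta> > 0" and v: "v \<in> Cinf_per Y" and \<phi>: "\<phi> \<in> Cinf_per Y"
  shows "(LINT x:cell Y|lebesgue. v x * pderiv_at \<alpha> \<phi> x)
    = - (LINT x:cell Y|lebesgue. pderiv_at \<alpha> v x * \<phi> x)"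
proof -
  note v = Cinf_perD[OF v] and \<phi> = Cinf_perD[OF \<phi>]
  have eq: "pderiv_at \<alpha> (\<lambda>x. v x * \<phi> x) = (\<lambda>x. v x * pderiv_at \<alpha> \<phi> x + pderiv_at \<alpha> v x * \<phi> x)"
    using v(2) \<phi>(2) by (simp add: pderiv_at_mult fun_eq_iff)
  have c: "continuous_on UNIV (\<lambda>x. v x * pderiv_at \<alpha> \<phi> x)" "continuous_on UNIV (\<lambda>x. pderiv_at \<alpha> v x * \<phi> x)"
    using v \<phi> by (auto intro!: continuous_intros)
  have "integral (cell Y) (pderiv_at \<alpha> (\<lambda>x. v x * \<phi> x)) = 0"
    using Y
  proof (rule integral_pderiv_periodic)
    show "periodic Y (\<lambda>x. v x * \<phi> x)" using v(1) \<phi>(1) by (simp add: periodic_def)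
    show "(\<lambda>x. v x * \<phi> x) differentiable (at x)" for x
      using v(2) \<phi>(2) by (intro differentiable_mult)
    show "continuous_on UNIV (pderiv_at \<alpha> (\<lambda>x. v x * \<phi> x))"
      unfolding eq using c by (rule continuous_on_add)
  qed
  then have "(LINT x:cell Y|lebesgue. v x * pderiv_at \<alpha> \<phi> x + pderiv_at \<alpha> v x * \<phi> x) = 0"
    unfolding eq using c by (simp add: set_lebesgue_integral_continuous_cell continuous_on_add)
  then show ?thesis
    using set_integral_add(2)[OF set_integrable_continuous_cell[OF c(1)] set_integrable_continuous_cell[OF c(2)], of Y]
    by simp
qed

lemma C0_per_subset_L2_per:
  fixes f :: "real^'n \<Rightarrow> 'a::euclidean_space"
  assumes "f \<in> C0_per Y"
  shows "f \<in> L2_per Y"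
proof -
  have cont: "continuous_on UNIV f" and per: "periodic Y f" using assms by (simp_all add: C0_per_def)
  have "set_integrable lebesgue K (\<lambda>x. (norm (f x))\<^sup>2)" if "compact K" for K
  proof -
    have "integrable lborel (\<lambda>x. indicator K x *\<^sub>R (norm (f x))\<^sup>2)"
      by (rule borel_integrable_compact[OF that])
        (intro continuous_intros continuous_on_subset[OF cont], simp)
    then show ?thesis unfolding set_integrable_def
      by (subst integrable_completion) auto
  qed
  moreover have "f \<in> borel_measurable lebesgue"
    by (rule measurable_completion) (simp add: borel_measurable_continuous_onI[OF cont])
  ultimately show ?thesis using per by (simp add: L2_per_def)
qed

text \<open>On the compact cell \<open>u\<close> is bounded and square integrability implies
  integrability. This justifies splitting the curl integral into two.\<close>

lemma set_integrable_cell_L2_mult: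
  fixes g :: "real^'n \<Rightarrow> real^'n"
  assumes g: "g \<in> L2_per Y" and u: "continuous_on UNIV (u :: real^'n \<Rightarrow> real)"
  shows "set_integrable lebesgue (cell Y) (\<lambda>x. u x * g x $ \<beta>)"
proof -
  have comp: "compact (cell Y)" by (simp add: cell_def compact_cbox)
  have sets: "cell Y \<in> sets lebesgue" by (simp add: cell_def)
  have meas: "g \<in> borel_measurable lebesgue" "u \<in> borel_measurable lebesgue"
    using g by (simp_all add: L2_per_def measurable_completion borel_measurable_continuous_onI[OF u])
  obtain C where C: "\<And>x. x \<in> cell Y \<Longrightarrow> \<bar>u x\<bar> \<le> C"
    using compact_imp_bounded[OF compact_continuous_image[OF continuous_on_subset[OF u] comp]]
    by (auto simp: bounded_iff)
  have "set_integrable lebesgue (cell Y) (\<lambda>x. (norm (g x))\<^sup>2)"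
    using g comp by (simp add: L2_per_def)
  moreover have "set_integrable lebesgue (cell Y) (\<lambda>x. 1::real)"
    by (rule set_integrable_continuous_cell) simp
  ultimately have "set_integrable lebesgue (cell Y) (\<lambda>x. C * (1 + (norm (g x))\<^sup>2))"
    by (intro set_integrable_mult_right set_integral_add(1)) simp_all
  then show ?thesis
  proof (rule set_integrable_bound)
    have "(\<lambda>x. g x $ \<beta>) \<in> borel_measurable lebesgue"
      using measurable_compose[OF meas(1), of "\<lambda>y. y $ \<beta>" borel] by simp
    then show "set_borel_measurable lebesgue (cell Y) (\<lambda>x. u x * g x $ \<beta>)"
      unfolding set_borel_measurable_def using meas sets by simp
    have "\<bar>u x * g x $ \<beta>\<bar> \<le> C * (1 + (norm (g x))\<^sup>2)" if "x \<in> cell Y" for x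
    proof -
      have "\<bar>g x $ \<beta>\<bar> \<le> norm (g x)" by (rule component_le_norm_cart)
      also have "\<dots> \<le> 1 + (norm (g x))\<^sup>2"
        \<comment> \<open>The square of \<open>norm (g x) - 1 / 2\<close> being nonnegative bounds
          the norm by its square plus 1/4.\<close>
        using zero_le_power2[of "norm (g x) - 1 / 2"] by (simp add: power2_diff power_divide)
      finally show ?thesis unfolding abs_mult
        using C[OF that] abs_ge_zero[of "u x"] by (intro mult_mono) linarith+
    qed
    then show "AE x in lebesgue. x \<in> cell Y \<longrightarrow> norm (u x * g x $ \<beta>) \<le> norm (C * (1 + (norm (g x))\<^sup>2))"
      by (intro AE_I2 impI) (metis abs_ge_self order_trans real_norm_def)
  qed
qed

section \<open>Real trigonometric polynomials\<close>

text \<open>Taking the real part gives a real function for arbitrary coefficients; Hermitian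
  symmetry enters only when the complex sum has to be recovered, in
  \<open>of_real_rtrig\<close>.\<close>

definition rtrig :: "real^'n \<Rightarrow> nat^'n \<Rightarrow> (int^'n \<Rightarrow> complex) \<Rightarrow> real^'n \<Rightarrow> real" where
  "rtrig Y N a x = Re (\<Sum>l\<in>idx N. a l * four Y l x)"

lemma has_derivative_four:
  "(four Y k has_derivative (\<lambda>h. \<i> * of_real (pi * (freq Y k \<bullet> h)) * four Y k x)) (at x)"
proof -
  have "((\<lambda>x. \<i> * of_real (pi * (freq Y k \<bullet> x))) has_derivative (\<lambda>h. \<i> * of_real (pi * (freq Y k \<bullet> h)))) (at x)"
    by (intro has_derivative_mult_right has_derivative_of_real has_derivative_inner_right has_derivative_ident)
  then show ?thesis
    unfolding four_def[abs_def]
    using has_derivative_compose[OF _ DERIV_exp[unfolded has_field_derivative_def]]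
    by (fastforce simp: mult.commute)
qed

lemma has_derivative_rtrig:
  "(rtrig Y N a has_derivative (\<lambda>h. Re (\<Sum>l\<in>idx N. a l * (\<i> * of_real (pi * (freq Y l \<bullet> h)) * four Y l x)))) (at x)"
  unfolding rtrig_def[abs_def]
  by (intro has_derivative_Re has_derivative_sum has_derivative_mult_right has_derivative_four)

text \<open>Differentiation only changes the coefficients. Smoothness thus becomes an induction over
  all coefficients, and the curl of such a field is an admissible \<open>v\<close> in
  \<open>curl_free\<close>.\<close>

lemma pderiv_at_rtrig:
  "pderiv_at \<alpha> (rtrig Y N a) = rtrig Y N (\<lambda>l. \<i> * of_real (pi * freq Y l $ \<alpha>) * a l)"
proof
  fix x
  show "pderiv_at \<alpha> (rtrig Y N a) x = rtrig Y N (\<lambda>l. \<i> * of_real (pi * freq Y l $ \<alpha>) * a l) x"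
    unfolding pderiv_at_def frechet_derivative_at[OF has_derivative_rtrig, symmetric]
    by (simp add: rtrig_def inner_axis mult_ac)
qed

lemma rtrig_differentiable: "rtrig Y N a differentiable (at x)"
  using has_derivative_rtrig by (rule differentiableI)

lemma rtrig_continuous: "continuous_on UNIV (rtrig Y N a)"
  by (intro continuous_at_imp_continuous_on ballI differentiable_imp_continuous_within
      rtrig_differentiable)

lemma rtrig_periodic:
  assumes "\<And>\<alpha>. Y $ \<alpha> > 0"
  shows "periodic Y (rtrig Y N a)"
proof -
  have "four Y k (x + axis \<alpha> (2 * Y $ \<alpha>)) = four Y k x" for k x \<alpha>
  proof -
    have "freq Y k \<bullet> axis \<alpha> (2 * Y $ \<alpha>) = 2 * of_int (k $ \<alpha>)"
      using assms[of \<alpha>] by (simp add: freq_def inner_axis)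
    then have "four Y k (x + axis \<alpha> (2 * Y $ \<alpha>))
        = four Y k x * exp (\<i> * of_real (pi * (2 * of_int (k $ \<alpha>))))"
      by (simp add: four_def inner_add_right ring_distribs exp_add)
    also have "exp (\<i> * of_real (pi * (2 * of_int (k $ \<alpha>)))) = 1"
      by (auto simp: exp_eq_1)
    finally show ?thesis by simp
  qed
  then show ?thesis by (simp add: periodic_def rtrig_def)
qed

lemma rtrig_Cinf_per:
  assumes "\<And>\<alpha>. Y $ \<alpha> > 0"
  shows "rtrig Y N a \<in> Cinf_per Y"
proof -
  have "Ck j (rtrig Y N a)" for j
    by (induction j arbitrary: a) (simp_all add: rtrig_continuous rtrig_differentiable pderiv_at_rtrig)
  then show ?thesis using rtrig_periodic[OF assms] by (simp add: Cinf_per_def)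
qed

lemma rtrig_diff: "rtrig Y N (\<lambda>l. a l - b l) x = rtrig Y N a x - rtrig Y N b x"
  by (simp add: rtrig_def left_diff_distrib sum_subtractf)

lemma rtrig_field_L2:
  assumes "\<And>\<alpha>. Y $ \<alpha> > 0"
  shows "(\<lambda>x. \<chi> \<alpha>. rtrig Y N (a \<alpha>) x) \<in> L2_per Y"
  using rtrig_periodic[OF assms]
  by (intro C0_per_subset_L2_per)
    (auto simp: C0_per_def periodic_def intro!: continuous_on_vec_lambda rtrig_continuous)

lemma weak_gradient_rtrig:
  assumes Y: "\<And>\<alpha>. Y $ \<alpha> > 0"
  shows "weak_gradient Y (rtrig Y N a) (\<lambda>x. \<chi> \<alpha>. pderiv_at \<alpha> (rtrig Y N a) x)"
  unfolding weak_gradient_def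
  using integral_by_parts_cell[OF Y rtrig_Cinf_per[OF Y]] rtrig_field_L2[OF Y]
  by (simp add: pderiv_at_rtrig)

lemma rtrig_H1_per:
  assumes Y: "\<And>\<alpha>. Y $ \<alpha> > 0"
  shows "rtrig Y N a \<in> H1_per Y"
proof -
  have "rtrig Y N a \<in> L2_per Y"
    by (intro C0_per_subset_L2_per) (simp add: C0_per_def rtrig_periodic[OF Y] rtrig_continuous)
  then show ?thesis using weak_gradient_rtrig[OF Y] by (auto simp: H1_per_def)
qed

text \<open>Necessity follows by testing with the curl itself.\<close>

lemma curl_free_rtrig_iff:
  fixes a :: "'n::finite \<Rightarrow> int^'n \<Rightarrow> complex"
  assumes Y: "\<And>\<alpha>. Y $ \<alpha> > 0"
  shows "curl_free Y (\<lambda>x. \<chi> \<alpha>. rtrig Y N (a \<alpha>) x) \<longleftrightarrow>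
    (\<forall>\<alpha> \<beta>. \<forall>x\<in>cell Y. pderiv_at \<beta> (rtrig Y N (a \<alpha>)) x = pderiv_at \<alpha> (rtrig Y N (a \<beta>)) x)"
    (is "?L \<longleftrightarrow> ?R")
proof -
  \<comment> \<open>Trigonometric polynomials are smooth and periodic, so they may serve as test
    functions in \<open>weak_gradient\<close>; this moves the derivative from \<open>v\<close> to
    the field.\<close>
  have tested: "(LINT x:cell Y|lebesgue. rtrig Y N (a \<alpha>) x * g x $ \<beta> - rtrig Y N (a \<beta>) x * g x $ \<alpha>)
      = (LINT x:cell Y|lebesgue. v x * pderiv_at \<alpha> (rtrig Y N (a \<beta>)) x)
        - (LINT x:cell Y|lebesgue. v x * pderiv_at \<beta> (rtrig Y N (a \<alpha>)) x)"
    if "weak_gradient Y v g" for v g \<alpha> \<beta>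
  proof -
    have g: "g \<in> L2_per Y" and wg: "\<And>\<gamma> b. (LINT x:cell Y|lebesgue. v x * pderiv_at \<gamma> (rtrig Y N b) x)
        = - (LINT x:cell Y|lebesgue. rtrig Y N b x * g x $ \<gamma>)"
      using that rtrig_Cinf_per[OF Y] by (simp_all add: weak_gradient_def mult.commute)
    show ?thesis
      by (subst set_integral_diff(2)[OF set_integrable_cell_L2_mult[OF g rtrig_continuous]
            set_integrable_cell_L2_mult[OF g rtrig_continuous]])
        (simp add: wg)
  qed
  show ?thesis
  proof
    assume R: ?R
    have "(LINT x:cell Y|lebesgue. v x * pderiv_at \<alpha> (rtrig Y N (a \<beta>)) x)
        = (LINT x:cell Y|lebesgue. v x * pderiv_at \<beta> (rtrig Y N (a \<alpha>)) x)" for v \<alpha> \<beta>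
      by (rule set_lebesgue_integral_cong) (use R in \<open>auto simp: cell_def\<close>)
    then show ?L unfolding curl_free_def by (simp add: tested)
  next
    assume L: ?L
    show ?R
    proof (intro allI)
      fix \<alpha> \<beta>
      \<comment> \<open>\<open>c\<close> holds the coefficients of one curl component. Testing with
        it makes the integral of its square zero, and by continuity it vanishes on the cell.\<close>
      define c where "c l = \<i> * of_real (pi * freq Y l $ \<alpha>) * a \<beta> l - \<i> * of_real (pi * freq Y l $ \<beta>) * a \<alpha> l" for l
      have c: "rtrig Y N c x = pderiv_at \<alpha> (rtrig Y N (a \<beta>)) x - pderiv_at \<beta> (rtrig Y N (a \<alpha>)) x" for x
        unfolding c_def[abs_def] rtrig_diff pderiv_at_rtrig ..
      have cont: "continuous_on UNIV (\<lambda>x. rtrig Y N c x * pderiv_at \<gamma> (rtrig Y N b) x)" for \<gamma> b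
        unfolding pderiv_at_rtrig by (intro continuous_intros rtrig_continuous)
      note wg = weak_gradient_rtrig[OF Y, of N c]
      have "(LINT x:cell Y|lebesgue. rtrig Y N (a \<alpha>) x * (\<chi> \<gamma>. pderiv_at \<gamma> (rtrig Y N c) x) $ \<beta>
          - rtrig Y N (a \<beta>) x * (\<chi> \<gamma>. pderiv_at \<gamma> (rtrig Y N c) x) $ \<alpha>) = 0"
        using L[unfolded curl_free_def, rule_format, OF rtrig_H1_per[OF Y] wg, of \<alpha> \<beta>] by simp
      then have "0 = (LINT x:cell Y|lebesgue. rtrig Y N c x * pderiv_at \<alpha> (rtrig Y N (a \<beta>)) x)
          - (LINT x:cell Y|lebesgue. rtrig Y N c x * pderiv_at \<beta> (rtrig Y N (a \<alpha>)) x)"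
        unfolding tested[OF wg] by simp
      also have "\<dots> = (LINT x:cell Y|lebesgue. rtrig Y N c x * rtrig Y N c x)"
        unfolding c[symmetric]
        by (subst set_integral_diff(2)[OF set_integrable_continuous_cell[OF cont]
              set_integrable_continuous_cell[OF cont], symmetric]) (simp add: c algebra_simps)
      also have "\<dots> = integral (cell Y) (\<lambda>x. rtrig Y N c x * rtrig Y N c x)"
        by (intro set_lebesgue_integral_continuous_cell continuous_intros rtrig_continuous)
      finally have "integral (cbox (- Y) Y) (\<lambda>x. rtrig Y N c x * rtrig Y N c x) = 0"
        by (simp add: cell_def)
      moreover have "box (- Y) Y \<noteq> {}"
        using Y by (auto simp: interval_ne_empty_cart intro: less_trans[of _ 0])
      moreover have "continuous_on (cbox (- Y) Y) (\<lambda>x. rtrig Y N c x * rtrig Y N c x)"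
        by (intro continuous_intros continuous_on_subset[OF rtrig_continuous]) simp_all
      ultimately have "\<forall>x\<in>cell Y. rtrig Y N c x * rtrig Y N c x = 0"
        unfolding cell_def by (subst (asm) integral_cbox_eq_0_iff) auto
      then show "\<forall>x\<in>cell Y. pderiv_at \<beta> (rtrig Y N (a \<alpha>)) x = pderiv_at \<alpha> (rtrig Y N (a \<beta>)) x"
        by (simp add: c)
    qed
  qed
qed

section \<open>Conjugation symmetry, grid values and means of trigonometric polynomials\<close>

lemma freq_uminus: "freq Y (- l) = - freq Y l"
  by (simp add: freq_def vec_eq_iff)

lemma freq_eq_0_iff:
  assumes "\<And>\<alpha>. Y $ \<alpha> > 0"
  shows "freq Y l = 0 \<longleftrightarrow> l = 0"
proof -
  have "Y $ \<alpha> \<noteq> 0" for \<alpha> using assms[of \<alpha>] by simp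
  then show ?thesis by (simp add: freq_def vec_eq_iff)
qed

text \<open>At \<open>l = 0\<close> the quotient is a division by zero, whose value zero is the
  block prescribed there.\<close>

lemma Ghat_mat_diag:
  assumes "\<And>\<alpha>. Y $ \<alpha> > 0"
  shows "Ghat_mat Y l l $ \<alpha> $ \<beta> = freq Y l $ \<alpha> * freq Y l $ \<beta> / (norm (freq Y l))\<^sup>2"
  by (cases "l = 0") (simp_all add: Ghat_mat_def freq_eq_0_iff[OF assms, THEN iffD2])

text \<open>Conjugating the sum amounts to replacing \<open>l\<close> by \<open>- l\<close>, which
  permutes \<open>idx N\<close>; the sum is real and its real part loses nothing.\<close>

lemma of_real_rtrig:
  assumes N: "\<And>\<alpha>. odd (N $ \<alpha>)" and a: "\<And>l. l \<in> idx N \<Longrightarrow> a (- l) = cnj (a l)"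
  shows "complex_of_real (rtrig Y N a x) = (\<Sum>l\<in>idx N. a l * four Y l x)"
proof -
  have four: "cnj (four Y l x) = four Y (- l) x" for l
    by (simp add: four_def exp_cnj freq_uminus)
  have "cnj (\<Sum>l\<in>idx N. a l * four Y l x) = (\<Sum>l\<in>idx N. a (- l) * four Y (- l) x)"
    by (simp add: four a)
  also have "\<dots> = (\<Sum>l\<in>idx N. a l * four Y l x)"
    by (rule sum.reindex_bij_witness[of _ uminus uminus]) (simp_all add: idx_uminus N)
  finally have "(\<Sum>l\<in>idx N. a l * four Y l x) \<in> \<real>" by (simp only: Reals_cnj_iff)
  then show ?thesis unfolding rtrig_def by (rule of_real_Re)
qed

lemma rtrig_cong: "(\<And>l. l \<in> idx N \<Longrightarrow> a l = b l) \<Longrightarrow> rtrig Y N a = rtrig Y N b"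
  by (auto simp: rtrig_def fun_eq_iff intro!: arg_cong[of _ _ Re] sum.cong)

lemma rtrig_grid:
  assumes Y: "\<And>\<alpha>. Y $ \<alpha> > 0" and N: "\<And>\<alpha>. odd (N $ \<alpha>)"
    and a: "\<And>l. l \<in> idx N \<Longrightarrow> a (- l) = cnj (a l)"
  shows "complex_of_real (rtrig Y N a (grid Y N k)) = (\<Sum>l\<in>idx N. a l * omega N k l)"
  using of_real_rtrig[of N a, OF N a] by (simp add: four_grid[OF Y])

text \<open>Vanishing of the curl and ellipticity are obtained pointwise on the cell, and this
  carries them to the grid.\<close>

lemma grid_in_cell:
  assumes Y: "\<And>\<alpha>. Y $ \<alpha> > 0" and N: "\<And>\<alpha>. odd (N $ \<alpha>)" and k: "k \<in> idx N"
  shows "grid Y N k \<in> cell Y"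
proof -
  have "- Y $ \<alpha> \<le> grid Y N k $ \<alpha> \<and> grid Y N k $ \<alpha> \<le> Y $ \<alpha>" for \<alpha>
  proof -
    have pos: "real (N $ \<alpha>) > 0" using N[of \<alpha>] by (simp add: odd_pos)
    define t where "t = 2 * real_of_int (k $ \<alpha>) / real (N $ \<alpha>)"
    have "- (real (N $ \<alpha>) / 2) \<le> real_of_int (k $ \<alpha>)" "real_of_int (k $ \<alpha>) < real (N $ \<alpha>) / 2"
      using k by (auto simp: idx_def)
    then have "- 1 \<le> t" "t \<le> 1" using pos by (simp_all add: t_def field_simps)
    then have "- 1 * Y $ \<alpha> \<le> t * Y $ \<alpha>" "t * Y $ \<alpha> \<le> 1 * Y $ \<alpha>"
      using Y[of \<alpha>] by (intro mult_right_mono; simp)+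
    then show ?thesis by (simp add: grid_def t_def mult_ac)
  qed
  then show ?thesis by (simp add: cell_def mem_box_cart)
qed

lemma integral_rtrig_gradient:
  assumes Y: "\<And>\<alpha>. Y $ \<alpha> > 0" and a: "\<And>l. l \<in> idx N \<Longrightarrow> a l = of_real (freq Y l $ \<alpha>) * d l"
  shows "integral (cell Y) (rtrig Y N a) = 0"
proof -
  \<comment> \<open>Dividing by \<open>i pi\<close> undoes the scalar factor of differentiation, so
    \<open>d\<close> yields a periodic antiderivative in direction \<open>\<alpha>\<close>.\<close>
  have eq: "rtrig Y N a = pderiv_at \<alpha> (rtrig Y N (\<lambda>l. d l / (\<i> * of_real pi)))"
    unfolding pderiv_at_rtrig by (rule rtrig_cong) (simp add: a)
  show ?thesis
    unfolding eq
    by (rule integral_pderiv_periodic)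
      (simp_all add: Y rtrig_periodic rtrig_differentiable pderiv_at_rtrig rtrig_continuous)
qed

text \<open>Without its zero frequency the polynomial is a derivative of a periodic function, so
  only the constant contributes. This turns the zero mean of a field into a condition on its
  coefficient at zero.\<close>

lemma integral_rtrig:
  fixes Y :: "real^'n"
  assumes Y: "\<And>\<alpha>. Y $ \<alpha> > 0" and N: "\<And>\<alpha>. odd (N $ \<alpha>)"
    and a: "\<And>l. l \<in> idx N \<Longrightarrow> l \<noteq> 0 \<Longrightarrow> a l = of_real (freq Y l $ \<alpha>) * d l"
  shows "integral (cell Y) (rtrig Y N a) = measure lborel (cell Y) * Re (a 0)"
proof -
  define a' where "a' l = (if l = 0 then 0 else a l)" for l
  have 0: "0 \<in> idx N" using N by (simp add: idx_odd)
  have "four Y 0 x = 1" for x by (simp add: four_def freq_def zero_vec_def[symmetric])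
  then have "rtrig Y N (\<lambda>l. a l - a' l) x = Re (a 0)" for x
    unfolding rtrig_def a'_def
    by (subst sum.remove[OF finite_idx 0]) (simp add: sum.neutral)
  then have *: "rtrig Y N a x = Re (a 0) + rtrig Y N a' x" for x
    by (simp add: rtrig_diff algebra_simps)
  have "integral (cell Y) (rtrig Y N a') = 0"
    by (rule integral_rtrig_gradient[OF Y, of N a' \<alpha> "\<lambda>l. if l = 0 then 0 else d l"])
      (simp add: a'_def a)
  moreover have "integral (cell Y) (rtrig Y N a) = integral (cell Y) (\<lambda>x. Re (a 0)) + integral (cell Y) (rtrig Y N a')"
    unfolding * cell_def
    by (intro integral_add integrable_const integrable_continuous continuous_on_subset[OF rtrig_continuous]) simp
  ultimately show ?thesis by (simp add: cell_def)
qed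

lemma set_lebesgue_integral_rtrig_field:
  "(LINT x:cell Y|lebesgue. (\<chi> \<alpha>. rtrig Y N (a \<alpha>) x)) $ \<alpha> = integral (cell Y) (rtrig Y N (a \<alpha>))"
proof -
  have cont: "continuous_on UNIV (\<lambda>x. \<chi> \<alpha>. rtrig Y N (a \<alpha>) x)"
    by (intro continuous_on_vec_lambda rtrig_continuous)
  have "(\<lambda>x. \<chi> \<alpha>. rtrig Y N (a \<alpha>) x) integrable_on cell Y"
    by (rule set_lebesgue_integral_eq_integral(1)[OF set_integrable_continuous_cell[OF cont]])
  from integral_component_eq_cart[OF this, of \<alpha>]
  show ?thesis unfolding set_lebesgue_integral_continuous_cell[OF cont] by simp
qed

section \<open>The discrete compatible fields as the range of the projection\<close>

lemma sapply_G_mat_in_Ebb: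
  fixes Y :: "real^'n"
  assumes Y: "\<And>\<alpha>. Y $ \<alpha> > 0" and N: "\<And>\<alpha>. odd (N $ \<alpha>)"
  shows "sapply N (G_mat Y N) w \<in> Ebb Y N"
proof -
  \<comment> \<open>Divided by \<open>i pi\<close>, these are the coefficients of a potential: a
    frequency times a scalar is the coefficient of a gradient, which settles both curl and
    mean.\<close>
  define D where "D l = (\<Sum>\<beta>\<in>UNIV. of_real (freq Y l $ \<beta>) * dft N (\<lambda>m. of_real (w m $ \<beta>)) l)
      / of_real ((norm (freq Y l))\<^sup>2)" for l
  define a where "a \<alpha> l = of_real (freq Y l $ \<alpha>) * D l" for \<alpha> l
  define u where "u x = (\<chi> \<alpha>. rtrig Y N (a \<alpha>) x)" for x
  have a_eq: "(\<Sum>\<beta>\<in>UNIV. of_real (Ghat_mat Y l l $ \<alpha> $ \<beta>) * dft N (\<lambda>m. of_real (w m $ \<beta>)) l) = a \<alpha> l"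
    for \<alpha> l
    by (simp add: Ghat_mat_diag[OF Y] a_def D_def sum_distrib_left sum_divide_distrib mult_ac)
  have a_sym: "a \<alpha> (- l) = cnj (a \<alpha> l)" for \<alpha> l
    by (simp add: a_def D_def freq_uminus dft_uminus sum_negf)
  have curl: "curl_free Y u"
    unfolding u_def[abs_def] curl_free_rtrig_iff[OF Y] pderiv_at_rtrig
    by (simp add: a_def mult_ac)
  have mean: "(LINT x:cell Y|lebesgue. u x) = 0"
    unfolding vec_eq_iff u_def[abs_def] set_lebesgue_integral_rtrig_field
    using integral_rtrig_gradient[OF Y, of N "a \<alpha>" \<alpha> D for \<alpha>] by (simp add: a_def[abs_def])
  have "(\<lambda>x. \<chi> \<alpha>. complex_of_real (u x $ \<alpha>)) = (\<lambda>x. \<Sum>l\<in>idx N. four Y l x *s (\<chi> \<alpha>. a \<alpha> l))"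
    by (simp add: fun_eq_iff vec_eq_iff u_def of_real_rtrig[OF N] a_sym sum_component mult.commute)
  then have "(\<lambda>x. \<chi> \<alpha>. complex_of_real (u x $ \<alpha>)) \<in> trig_poly Y N"
    unfolding trig_poly_def mem_Collect_eq
    by (intro exI[of _ "\<lambda>l. \<chi> \<alpha>. a \<alpha> l"] conjI) (simp_all add: a_sym)
  moreover have "u \<in> L2_per Y" unfolding u_def[abs_def] by (rule rtrig_field_L2[OF Y])
  ultimately have u: "u \<in> EN_space Y N" using curl mean by (simp add: EN_space_def Espace_def)
  have "complex_of_real (sapply N (G_mat Y N) w k $ \<alpha>) = complex_of_real (u (grid Y N k) $ \<alpha>)"
    if "k \<in> idx N" for k \<alpha>
    by (simp add: sapply_G_mat[OF N that] a_eq u_def rtrig_grid[OF Y N] a_sym)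
  then have "sapply N (G_mat Y N) w k = svec_of N (\<lambda>k. u (grid Y N k)) k" for k
    by (cases "k \<in> idx N") (simp_all add: svec_of_def sapply_outside vec_eq_iff)
  then have "sapply N (G_mat Y N) w = svec_of N (\<lambda>k. u (grid Y N k))" by (rule ext)
  then show ?thesis using u by (auto simp: Ebb_def)
qed

text \<open>The curl condition makes the coefficient at a nonzero \<open>l\<close> parallel to
  \<open>freq Y l\<close>, and the mean condition removes the one at zero.\<close>

lemma EN_space_coefficients:
  fixes Y :: "real^'n"
  assumes Y: "\<And>\<alpha>. Y $ \<alpha> > 0" and N: "\<And>\<alpha>. odd (N $ \<alpha>)" and u: "u \<in> EN_space Y N"
  obtains a where "u = (\<lambda>x. \<chi> \<alpha>. rtrig Y N (a \<alpha>) x)"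
    and "\<And>\<alpha> l. l \<in> idx N \<Longrightarrow> a \<alpha> (- l) = cnj (a \<alpha> l)"
    and "\<And>\<alpha> l. l \<in> idx N \<Longrightarrow> (\<Sum>\<beta>\<in>UNIV. of_real (Ghat_mat Y l l $ \<alpha> $ \<beta>) * a \<beta> l) = a \<alpha> l"
proof -
  obtain c where c: "(\<lambda>x. \<chi> \<alpha>. complex_of_real (u x $ \<alpha>)) = (\<lambda>x. \<Sum>l\<in>idx N. four Y l x *s c l)"
    and c_sym: "\<And>l \<alpha>. l \<in> idx N \<Longrightarrow> c l $ \<alpha> = cnj (c (- l) $ \<alpha>)"
    using u unfolding EN_space_def trig_poly_def by blast
  define a where "a \<alpha> l = c l $ \<alpha>" for \<alpha> l
  have a_sym: "a \<alpha> (- l) = cnj (a \<alpha> l)" if "l \<in> idx N" for \<alpha> l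
    using c_sym[OF that] by (simp add: a_def)
  have "complex_of_real (u x $ \<alpha>) = (\<Sum>l\<in>idx N. a \<alpha> l * four Y l x)" for x \<alpha>
    using fun_cong[OF c, of x] by (simp add: vec_eq_iff sum_component a_def mult.commute)
  then have "u x $ \<alpha> = rtrig Y N (a \<alpha>) x" for x \<alpha>
    unfolding rtrig_def by (metis Re_complex_of_real)
  then have u_eq: "u = (\<lambda>x. \<chi> \<alpha>. rtrig Y N (a \<alpha>) x)"
    by (simp add: fun_eq_iff vec_eq_iff)
  have curl: "of_real (freq Y l $ \<beta>) * a \<alpha> l = of_real (freq Y l $ \<alpha>) * a \<beta> l"
    if l: "l \<in> idx N" for \<alpha> \<beta> l
  proof -
    define d where "d l = \<i> * of_real (pi * freq Y l $ \<beta>) * a \<alpha> l - \<i> * of_real (pi * freq Y l $ \<alpha>) * a \<beta> l" for l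
    have d_sym: "d (- l) = cnj (d l)" if "l \<in> idx N" for l
      by (simp add: d_def a_sym[OF that] freq_uminus)
    have "curl_free Y u" using u by (simp add: EN_space_def Espace_def)
    then have "rtrig Y N d x = 0" if "x \<in> cell Y" for x
      using that unfolding u_eq curl_free_rtrig_iff[OF Y] d_def[abs_def] rtrig_diff pderiv_at_rtrig
      by simp
    \<comment> \<open>The curl component vanishes at the grid points, and the transform of these
      zero values returns its coefficients \<open>d\<close>.\<close>
    then have "(\<Sum>l\<in>idx N. d l * omega N k l) = 0" if "k \<in> idx N" for k
      using rtrig_grid[OF Y N, of d k] d_sym grid_in_cell[OF Y N that] by simp
    then have "dft N (\<lambda>_. 0) l = d l"
      by (intro dft_inverse[OF N l]) simp
    then have "d l = 0" by (simp add: dft_def)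
    then have "\<i> * of_real pi * (of_real (freq Y l $ \<beta>) * a \<alpha> l)
        = \<i> * of_real pi * (of_real (freq Y l $ \<alpha>) * a \<beta> l)"
      by (simp add: d_def mult_ac)
    then show ?thesis by simp
  qed
  have G: "(\<Sum>\<beta>\<in>UNIV. of_real (Ghat_mat Y l l $ \<alpha> $ \<beta>) * a \<beta> l) = a \<alpha> l"
    if l: "l \<in> idx N" "l \<noteq> 0" for \<alpha> l
  proof -
    have nz: "norm (freq Y l) \<noteq> 0" using that freq_eq_0_iff[OF Y] by simp
    have "(\<Sum>\<beta>\<in>UNIV. of_real (Ghat_mat Y l l $ \<alpha> $ \<beta>) * a \<beta> l)
        = (\<Sum>\<beta>\<in>UNIV. of_real (freq Y l $ \<beta>) * (of_real (freq Y l $ \<alpha>) * a \<beta> l)) / of_real ((norm (freq Y l))\<^sup>2)"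
      by (simp add: Ghat_mat_diag[OF Y] sum_divide_distrib mult_ac)
    \<comment> \<open>The curl relation exchanges the component of the coefficient with that of the
      frequency, leaving the squared norm of \<open>freq Y l\<close> as a factor.\<close>
    also have "\<dots> = (\<Sum>\<beta>\<in>UNIV. of_real ((freq Y l $ \<beta>)\<^sup>2)) * a \<alpha> l / of_real ((norm (freq Y l))\<^sup>2)"
    proof -
      have "of_real (freq Y l $ \<beta>) * (of_real (freq Y l $ \<alpha>) * a \<beta> l) = of_real ((freq Y l $ \<beta>)\<^sup>2) * a \<alpha> l" for \<beta>
        unfolding curl[OF l(1), where \<alpha> = \<alpha> and \<beta> = \<beta>, symmetric] by (simp add: power2_eq_square)
      then show ?thesis by (simp only: sum_distrib_right)
    qed
    also have "(\<Sum>\<beta>\<in>UNIV. complex_of_real ((freq Y l $ \<beta>)\<^sup>2)) = of_real ((norm (freq Y l))\<^sup>2)"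
      by (simp add: norm_vec_def L2_set_def sum_nonneg)
    finally show ?thesis using nz by simp
  qed
  \<comment> \<open>The zero frequency is its own negative, so Hermitian symmetry makes its
    coefficient real; the vanishing mean removes the real part.\<close>
  have zero: "a \<alpha> 0 = 0" for \<alpha>
  proof -
    define d where "d l = (\<Sum>\<beta>\<in>UNIV. of_real (freq Y l $ \<beta>) * a \<beta> l) / of_real ((norm (freq Y l))\<^sup>2)" for l
    have "a \<alpha> l = of_real (freq Y l $ \<alpha>) * d l" if "l \<in> idx N" "l \<noteq> 0" for l
      by (subst G[OF that, symmetric])
        (simp add: d_def Ghat_mat_diag[OF Y] sum_distrib_left sum_divide_distrib mult_ac)
    then have "integral (cell Y) (rtrig Y N (a \<alpha>)) = measure lborel (cell Y) * Re (a \<alpha> 0)"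
      by (rule integral_rtrig[OF Y N])
    moreover have "(LINT x:cell Y|lebesgue. u x) $ \<alpha> = 0"
      using u by (simp add: EN_space_def Espace_def)
    moreover have "measure lborel (cell Y) > 0"
    proof -
      have "box (- Y) Y \<noteq> {}" using Y by (auto simp: interval_ne_empty_cart intro: less_trans[of _ 0])
      then show ?thesis by (simp add: cell_def content_pos_lt_eq box_ne_empty)
    qed
    ultimately have "Re (a \<alpha> 0) = 0"
      unfolding u_eq set_lebesgue_integral_rtrig_field by simp
    moreover have "0 \<in> idx N" using N by (simp add: idx_odd)
    then have "a \<alpha> 0 = cnj (a \<alpha> 0)" using a_sym[of 0 \<alpha>] by simp
    then have "Im (a \<alpha> 0) = 0" by (simp add: complex_eq_iff)
    ultimately show ?thesis by (simp add: complex_eq_iff)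
  qed
  have "(\<Sum>\<beta>\<in>UNIV. of_real (Ghat_mat Y l l $ \<alpha> $ \<beta>) * a \<beta> l) = a \<alpha> l"
    if "l \<in> idx N" for \<alpha> l
    using G[OF that] zero by (cases "l = 0") simp_all
  with u_eq a_sym show thesis by (rule that)
qed

text \<open>As a fixed-point equation membership is linear: closure under combinations and vanishing
  outside \<open>idx N\<close> can be read off it.\<close>

lemma Ebb_iff:
  fixes Y :: "real^'n"
  assumes Y: "\<And>\<alpha>. Y $ \<alpha> > 0" and N: "\<And>\<alpha>. odd (N $ \<alpha>)"
  shows "v \<in> Ebb Y N \<longleftrightarrow> sapply N (G_mat Y N) v = v"
proof
  assume "sapply N (G_mat Y N) v = v"
  then show "v \<in> Ebb Y N" using sapply_G_mat_in_Ebb[OF Y N, of v] by simp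
next
  assume "v \<in> Ebb Y N"
  then obtain u where u: "u \<in> EN_space Y N" and v: "v = svec_of N (\<lambda>k. u (grid Y N k))"
    by (auto simp: Ebb_def)
  obtain a where u_eq: "u = (\<lambda>x. \<chi> \<alpha>. rtrig Y N (a \<alpha>) x)"
    and a_sym: "\<And>\<alpha> l. l \<in> idx N \<Longrightarrow> a \<alpha> (- l) = cnj (a \<alpha> l)"
    and G: "\<And>\<alpha> l. l \<in> idx N \<Longrightarrow> (\<Sum>\<beta>\<in>UNIV. of_real (Ghat_mat Y l l $ \<alpha> $ \<beta>) * a \<beta> l) = a \<alpha> l"
    using EN_space_coefficients[OF Y N u] by blast
  have v_eq: "complex_of_real (v k $ \<alpha>) = (\<Sum>l\<in>idx N. a \<alpha> l * omega N k l)" if "k \<in> idx N" for k \<alpha>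
    using that by (simp add: v u_eq svec_of_def rtrig_grid[OF Y N] a_sym)
  have dft: "dft N (\<lambda>m. of_real (v m $ \<beta>)) l = a \<beta> l" if "l \<in> idx N" for \<beta> l
    by (rule dft_inverse[OF N that v_eq])
  have "complex_of_real (sapply N (G_mat Y N) v k $ \<alpha>) = complex_of_real (v k $ \<alpha>)"
    if "k \<in> idx N" for k \<alpha>
    unfolding sapply_G_mat[OF N that] v_eq[OF that] by (simp add: dft G)
  then have "sapply N (G_mat Y N) v k = v k" for k
    by (cases "k \<in> idx N") (simp_all add: v svec_of_def sapply_outside vec_eq_iff)
  then show "sapply N (G_mat Y N) v = v" by (rule ext)
qed

text \<open>By continuity the good points form a closed set. The bad points of the open cell form an
  open null set, hence none exist, and passing to the closure adds the boundary.\<close>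

lemma coercive_on_cell:
  fixes A :: "real^'n \<Rightarrow> real^'n^'n"
  assumes Y: "\<And>\<alpha>. Y $ \<alpha> > 0" and A: "continuous_on UNIV A"
    and ae: "AE x in lebesgue. x \<in> cell Y \<longrightarrow>
      transpose (A x) = A x \<and> (\<forall>v. c * (norm v)\<^sup>2 \<le> (A x *v v) \<bullet> v)"
    and x: "x \<in> cell Y"
  shows "transpose (A x) = A x" "c * (norm v)\<^sup>2 \<le> (A x *v v) \<bullet> v"
proof -
  define S where "S = {x. transpose (A x) = A x \<and> (\<forall>v. c * (norm v)\<^sup>2 \<le> (A x *v v) \<bullet> v)}"
  have entry: "continuous_on UNIV (\<lambda>x. A x $ i $ j)" for i j
    by (intro continuous_on_component A)
  have "S = (\<Inter>i j. {x. A x $ j $ i = A x $ i $ j}) \<inter>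
      (\<Inter>v. {x. c * (norm v)\<^sup>2 \<le> (\<Sum>i\<in>UNIV. (\<Sum>j\<in>UNIV. A x $ i $ j * v $ j) * v $ i)})"
    by (auto simp: S_def vec_eq_iff transpose_def inner_vec_def matrix_vector_mult_def)
  also have "closed \<dots>"
    by (intro closed_Int closed_INT ballI closed_Collect_eq closed_Collect_le continuous_intros entry)
  finally have "closed S" .
  then have "open (box (- Y) Y - S)" by (intro open_Diff open_box)
  moreover have "negligible (box (- Y) Y - S)"
  proof -
    have "AE x in lebesgue. x \<notin> box (- Y) Y - S"
      using ae by eventually_elim (use box_subset_cbox[of "- Y" Y] in \<open>auto simp: S_def cell_def\<close>)
    moreover have "box (- Y) Y - S \<in> sets lebesgue"
      using \<open>open (box (- Y) Y - S)\<close> by simp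
    ultimately show ?thesis unfolding negligible_iff_null_sets by (subst AE_iff_null_sets)
  qed
  ultimately have "box (- Y) Y \<subseteq> S" using open_not_negligible by blast
  then have "closure (box (- Y) Y) \<subseteq> S" using \<open>closed S\<close> by (rule closure_minimal)
  moreover have "box (- Y) Y \<noteq> {}" using Y by (auto simp: interval_ne_empty_cart intro: less_trans[of _ 0])
  ultimately have "x \<in> S" using x by (auto simp: cell_def closure_box)
  then show "transpose (A x) = A x" "c * (norm v)\<^sup>2 \<le> (A x *v v) \<bullet> v" by (auto simp: S_def)
qed

lemma sapply_A_mat: "k \<in> idx N \<Longrightarrow> sapply N (A_mat Y N A) v k = A (grid Y N k) *v v k"
proof -
  assume k: "k \<in> idx N"
  have "(\<Sum>m\<in>idx N. A_mat Y N A k m *v v m) = (\<Sum>m\<in>idx N. if m = k then A (grid Y N k) *v v k else 0)"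
    by (intro sum.cong) (auto simp: A_mat_def)
  then show ?thesis using k by (simp add: sapply_def svec_of_def finite_idx)
qed

theorem lemma13:
  fixes Y :: "real^'n" and N :: "nat^'n" and A :: "real^'n \<Rightarrow> real^'n^'n" and E :: "real^'n"
    and cA CA :: real and e0 :: "'n svec"
  assumes "\<And>\<alpha>. Y $ \<alpha> > 0"
    and "\<And>\<alpha>. odd (N $ \<alpha>)"
    and "A \<in> C0_per Y"
    and "0 < cA" and "cA \<le> CA"
    and "AE x in lebesgue. x \<in> cell Y \<longrightarrow>
           transpose (A x) = A x \<and>
           (\<forall>v. cA * (norm v)\<^sup>2 \<le> (A x *v v) \<bullet> v \<and> (A x *v v) \<bullet> v \<le> CA * (norm v)\<^sup>2)"
    and "e0 \<in> Ebb Y N"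
  defines "B \<equiv> GA_mat Y N A" and "b \<equiv> rhs_vec Y N A E"
  shows "(\<forall>i. cg_residual (cg N B b e0 i) \<noteq> (\<lambda>_. 0) \<longrightarrow> cg_step_ok N B (cg N B b e0 i)) \<and>
    (\<exists>e. e \<in> Ebb Y N \<and> sapply N B e = b \<and>
         (\<forall>e'\<in>Ebb Y N. sapply N B e' = b \<longrightarrow> e' = e) \<and>
         (\<exists>n. cg_residual (cg N B b e0 n) = (\<lambda>_. 0) \<and> cg_iterate (cg N B b e0 n) = e))"
proof -
  note Y = assms(1) and N = assms(2)
  note Ebb = Ebb_iff[OF Y N]
  let ?G = "sapply N (G_mat Y N)" and ?A = "sapply N (A_mat Y N A)"
  have B: "sapply N B v = ?G (?A v)" for v by (simp add: B_def GA_mat_def sapply_smult)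
  have N_pos: "N $ \<alpha> > 0" for \<alpha> using N[of \<alpha>] by (rule odd_pos)
  have "continuous_on UNIV A" using assms(3) by (simp add: C0_per_def)
  moreover have "AE x in lebesgue. x \<in> cell Y \<longrightarrow>
      transpose (A x) = A x \<and> (\<forall>v. cA * (norm v)\<^sup>2 \<le> (A x *v v) \<bullet> v)"
    using assms(6) by eventually_elim auto
  ultimately have A_sym: "transpose (A (grid Y N k)) = A (grid Y N k)"
    and A_pos: "cA * (norm v)\<^sup>2 \<le> (A (grid Y N k) *v v) \<bullet> v" if "k \<in> idx N" for k v
    using coercive_on_cell[OF Y _ _ grid_in_cell[OF Y N that]] by blast+
  have A_self_adjoint: "sdot N (?A u) v = sdot N u (?A v)" for u v
    unfolding sdot_def
  proof (intro arg_cong2[of _ _ _ _ "(/)"] refl sum.cong)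
    fix k assume k: "k \<in> idx N"
    have "v k \<bullet> (A (grid Y N k) *v u k) = (transpose (A (grid Y N k)) *v v k) \<bullet> u k"
      by (simp add: transpose_matrix_vector dot_lmul_matrix)
    then show "?A u k \<bullet> v k = u k \<bullet> ?A v k"
      by (simp add: sapply_A_mat[OF k] A_sym[OF k] inner_commute)
  qed
  have supp: "v k = 0" if "v \<in> Ebb Y N" "k \<notin> idx N" for v k
    using that(1) unfolding Ebb by (metis sapply_outside that(2))
  \<comment> \<open>Self-adjointness moves \<open>G_mat\<close> onto \<open>v\<close>, which it
    fixes.\<close>
  have GA: "sdot N (sapply N B u) v = sdot N (?A u) v" if "v \<in> Ebb Y N" for u v
    using that unfolding B sapply_G_mat_symmetric[OF N] Ebb by simp
  interpret cg_on_subspace N B "Ebb Y N" b e0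
  proof
    show comb: "(\<lambda>k. u k + a *\<^sub>R v k) \<in> Ebb Y N" if "u \<in> Ebb Y N" "v \<in> Ebb Y N" for u v a
      using that by (simp add: Ebb sapply_add_scale)
    show "sapply N B v \<in> Ebb Y N" for v
      unfolding B by (rule sapply_G_mat_in_Ebb[OF Y N])
    \<comment> \<open>The closure property has the form \<open>u + a v\<close>, so the negative of a
      vector is written as the vector minus twice itself.\<close>
    then have "(\<lambda>k. sapply N B (E_vec N E) k + (-2) *\<^sub>R sapply N B (E_vec N E) k) \<in> Ebb Y N"
      by (intro comb)
    moreover have "b = (\<lambda>k. sapply N B (E_vec N E) k + (-2) *\<^sub>R sapply N B (E_vec N E) k)"
      by (simp add: b_def rhs_vec_def B_def fun_eq_iff vec_eq_iff)
    ultimately show "b \<in> Ebb Y N" by simp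
    show "sdot N (sapply N B u) v = sdot N u (sapply N B v)" if "u \<in> Ebb Y N" "v \<in> Ebb Y N" for u v
      using GA[OF that(2), of u] GA[OF that(1), of v] A_self_adjoint[of u v]
      by (simp only: sdot_commute[of N u])
    show "sdot N (sapply N B v) v > 0" if v: "v \<in> Ebb Y N" "v \<noteq> (\<lambda>_. 0)" for v
    proof -
      have "0 < cA * sdot N v v"
        using \<open>0 < cA\<close> sdot_pos[OF N_pos supp[OF v(1)] v(2)] by simp
      also have "\<dots> \<le> sdot N (?A v) v"
        unfolding sdot_def times_divide_eq_right sum_distrib_left
        by (intro divide_right_mono sum_mono) (simp_all add: sapply_A_mat A_pos dot_square_norm prod_nonneg)
      finally show ?thesis by (simp add: GA[OF v(1)])
    qed
  qed (use N_pos supp assms(7) in auto)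
  show ?thesis by (rule solves)
qed

end
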